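(* Let $X$ be a separable real Fréchet space whose topology is given by a countable system of norms $\{p_n\}_{n\in\mathbb{N}}$, and let $Y$ be a (real) Banach space. Suppose that for every $n\in\mathbb{N}$ the normed space $X_n=(X,p_n)$ admits a separating polynomial. Let $f:X\to Y$ be a function for which there exists $k\in\mathbb{N}$ such that for every sequence $\{x_m\}$ of points which is Cauchy in $X_k=(X,p_k)$, the sequence $\{f(x_m)\}\subset Y$ is convergent. Then $f$ is approximated by analytic functions uniformly on all of $X$: for every $\varepsilon>0$ there is an analytic map $H:X\to Y$ such that $\|f(x)-H(x)\|<\varepsilon$ for all $x\in X$.
   Context: A Fréchet space is a locally convex topological vector space metrizable by a complete metric. "With a countable system of norms $\{p_n\}$" means that each $p_n$ is a norm on $X$, that the topology of $X$ is the weakest one for which all $p_n$ are continuous, and that the metric $\rho(x,y)=\sum_n 2^{-n}\frac{p_n(x-y)}{1+p_n(x-y)}$ is complete. $X_n=(X,p_n)$ is the vector space $X$ with the single norm $p_n$ (not necessarily complete). An $n$-homogeneous polynomial $F_n$ from a vector space $X$ to a vector space $Y$ is a map $F_n(x)=B_n(x,\dots,x)$ with $B_n:X^n\to Y$ $n$-linear (for $n=0$, a constant). A polynomial is a finite sum of homogeneous polynomials. A separating polynomial on a real normed space $(Z,\|\cdot\|)$ is a continuous polynomial $P:Z\to\mathbb{R}$ such that $P(0)=0$ and $|P(z)|\ge 1$ for every $z\in Z$ with $\|z\|=1$. A map $F:X\to Y$ from a topological vector space $X$ to a normed space $Y$ is analytic if for every $x\in X$ there are a neighbourhood $V$ of $0$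 in $X$ and continuous $n$-homogeneous polynomials $F_n:X\to Y$ ($n\ge 0$) such that $F(x+h)=\sum_{n=0}^\infty F_n(h)$ for $h\in V$, the series converging uniformly on $V$ in the norm of $Y$. *)

theory Defs
  imports "HOL-Analysis.Analysis"
begin

definition norm_on_space :: "('a::real_vector \<Rightarrow> real) \<Rightarrow> bool" where
  "norm_on_space p \<longleftrightarrow>
     (\<forall>x. 0 \<le> p x) \<and> (\<forall>x. p x = 0 \<longleftrightarrow> x = 0) \<and>
     (\<forall>c x. p (c *\<^sub>R x) = \<bar>c\<bar> * p x) \<and> (\<forall>x y. p (x + y) \<le> p x + p y)"

definition norm_dist :: "('a::real_vector \<Rightarrow> real) \<Rightarrow> 'a \<Rightarrow> 'a \<Rightarrow> real" where
  "norm_dist p x y = p (x - y)"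

definition norm_topology :: "('a::real_vector \<Rightarrow> real) \<Rightarrow> 'a topology" where
  "norm_topology p = Metric_space.mtopology UNIV (norm_dist p)"

definition frechet_dist :: "(nat \<Rightarrow> 'a::real_vector \<Rightarrow> real) \<Rightarrow> 'a \<Rightarrow> 'a \<Rightarrow> real" where
  "frechet_dist p x y = (\<Sum>n. (1/2) ^ n * (p n (x - y) / (1 + p n (x - y))))"

text \<open>
  The topology of a Frechet space is translation invariant, so the weakest topology for which
  all norms are continuous is the initial topology of all maps sending \<open>x\<close> to \<open>p n (x - a)\<close>;
  the maps \<open>p n\<close> alone would only generate sets that are symmetric about the origin. The
  topology is then the one of the metric \<open>frechet_dist p\<close>, and it is locally convex.
\<close>
definition frechet_norms :: "(nat \<Rightarrow> 'a::{real_vector,topological_space} \<Rightarrow> real) \<Rightarrow> bool" where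
  "frechet_norms p \<longleftrightarrow>
     (\<forall>n. norm_on_space (p n)) \<and>
     (open :: 'a set \<Rightarrow> bool) =
        generate_topology {(\<lambda>x. p n (x - a)) -` U | n a U. open U} \<and>
     Metric_space.mcomplete UNIV (frechet_dist p)"

text \<open>Points of the \<open>n\<close>-fold product of a space are lists of length \<open>n\<close>.\<close>
definition n_linear :: "nat \<Rightarrow> ('a::real_vector list \<Rightarrow> 'b::real_vector) \<Rightarrow> bool" where
  "n_linear n B \<longleftrightarrow> (\<forall>xs. length xs = n \<longrightarrow> (\<forall>i<n. linear (\<lambda>z. B (xs[i := z]))))"

definition homogeneous_polynomial ::
    "nat \<Rightarrow> ('a::real_vector \<Rightarrow> 'b::real_vector) \<Rightarrow> bool" where
  "homogeneous_polynomial n F \<longleftrightarrow> (\<exists>B. n_linear n B \<and> (\<forall>x. F x = B (replicate n x)))"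

definition polynomial_map :: "('a::real_vector \<Rightarrow> 'b::real_vector) \<Rightarrow> bool" where
  "polynomial_map P \<longleftrightarrow>
     (\<exists>(N::nat) d F. (\<forall>i<N. homogeneous_polynomial (d i) (F i)) \<and> (\<forall>x. P x = (\<Sum>i<N. F i x)))"

definition separating_polynomial ::
    "('a::real_vector \<Rightarrow> real) \<Rightarrow> ('a \<Rightarrow> real) \<Rightarrow> bool" where
  "separating_polynomial p P \<longleftrightarrow>
     polynomial_map P \<and> continuous_map (norm_topology p) euclideanreal P \<and>
     P 0 = 0 \<and> (\<forall>z. p z = 1 \<longrightarrow> 1 \<le> \<bar>P z\<bar>)"

definition analytic_map ::
    "('a::{real_vector,topological_space} \<Rightarrow> 'b::real_normed_vector) \<Rightarrow> bool" where
  "analytic_map F \<longleftrightarrow>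
     (\<forall>x. \<exists>V G. (\<forall>\<^sub>F h in nhds 0. h \<in> V) \<and>
        (\<forall>n. continuous_on UNIV (G n) \<and> homogeneous_polynomial n (G n)) \<and>
        uniform_limit V (\<lambda>N h. \<Sum>n<N. G n h) (\<lambda>h. F (x + h)) sequentially)"

lemma Metric_space_norm_dist:
  assumes "norm_on_space p"
  shows "Metric_space UNIV (norm_dist p)"
proof
  fix x y z
  show "0 \<le> norm_dist p x y" and "norm_dist p x y = 0 \<longleftrightarrow> x = y"
    using assms by (auto simp: norm_on_space_def norm_dist_def)
  have "p ((-1) *\<^sub>R (x - y)) = p (x - y)"
    using assms unfolding norm_on_space_def by (metis abs_minus_cancel abs_one mult_1)
  then show "norm_dist p x y = norm_dist p y x"
    by (simp add: norm_dist_def)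
  have "p ((x - y) + (y - z)) \<le> p (x - y) + p (y - z)"
    using assms unfolding norm_on_space_def by blast
  then show "norm_dist p x z \<le> norm_dist p x y + norm_dist p y z"
    by (simp add: norm_dist_def)
qed

lemma Metric_space_frechet_dist:
  assumes "\<And>n. norm_on_space (p n)"
  shows "Metric_space UNIV (frechet_dist p)"
proof -
  let ?q = "\<lambda>n x y. (1/2) ^ n * (p n (x - y) / (1 + p n (x - y)))"
  have nn: "0 \<le> p n x" for n x
    using assms unfolding norm_on_space_def by blast
  have q_nn: "0 \<le> ?q n x y" for n x y
    using nn[of n "x - y"] by simp
  have q_le: "?q n x y \<le> (1/2) ^ n" for n x y
    using nn[of n "x - y"] by (intro mult_left_le) (auto simp: divide_simps)
  have summ: "summable (\<lambda>n. ?q n x y)" for x y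
  proof (rule summable_comparison_test'[OF summable_geometric[of "1/2::real"], of 0])
    show "norm (?q n x y) \<le> (1/2) ^ n" for n
      using q_nn[of n x y] q_le[of n x y] by (simp only: real_norm_def abs_of_nonneg)
  qed simp
  have mono: "s / (1 + s) \<le> t / (1 + t)" if "0 \<le> s" "s \<le> t" for s t :: real
    using that by (simp add: divide_simps algebra_simps)
  have sub: "(s + t) / (1 + (s + t)) \<le> s / (1 + s) + t / (1 + t)"
    if "0 \<le> s" "0 \<le> t" for s t :: real
  proof -
    have "s / (1 + (s + t)) \<le> s / (1 + s)" "t / (1 + (s + t)) \<le> t / (1 + t)"
      using that by (auto intro!: divide_left_mono)
    then show ?thesis by (simp add: add_divide_distrib)
  qed
  show ?thesis
  proof
    fix x y z
    show "0 \<le> frechet_dist p x y"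
      unfolding frechet_dist_def by (intro suminf_nonneg summ q_nn)
    have "frechet_dist p x y = 0 \<longleftrightarrow> (\<forall>n. ?q n x y = 0)"
      unfolding frechet_dist_def by (intro suminf_eq_zero_iff summ q_nn)
    also have "\<dots> \<longleftrightarrow> (\<forall>n. p n (x - y) = 0)"
    proof -
      have "1 + p n (x - y) \<noteq> 0" for n
        using nn[of n "x - y"] by linarith
      then show ?thesis by simp
    qed
    also have "\<dots> \<longleftrightarrow> x = y"
      using assms by (auto simp: norm_on_space_def)
    finally show "frechet_dist p x y = 0 \<longleftrightarrow> x = y" .
    show "frechet_dist p x y = frechet_dist p y x"
      using Metric_space.commute[OF Metric_space_norm_dist[OF assms], of _ x y]
      by (simp add: frechet_dist_def norm_dist_def)
    have "?q n x z \<le> ?q n x y + ?q n y z" for n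
    proof -
      have "p n (x - z) \<le> p n (x - y) + p n (y - z)"
        using Metric_space.triangle[OF Metric_space_norm_dist[OF assms[of n]], of x y z]
        by (simp add: norm_dist_def)
      then have "p n (x - z) / (1 + p n (x - z))
          \<le> p n (x - y) / (1 + p n (x - y)) + p n (y - z) / (1 + p n (y - z))"
        using mono[OF nn] sub[OF nn nn] by (meson order_trans)
      then show ?thesis
        unfolding distrib_left[symmetric] by (intro mult_left_mono) auto
    qed
    then show "frechet_dist p x z \<le> frechet_dist p x y + frechet_dist p y z"
      unfolding frechet_dist_def
      by (subst suminf_add[OF summ summ]) (intro suminf_le summ summable_add)
  qed
qed

end

theory Submission
  imports Defs
begin

text \<open>
  For the norm \<open>p k\<close> of the hypothesis on \<open>f\<close>, the map \<open>f\<close> is continuous, and every map that is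
  analytic for \<open>p k\<close> is analytic for the finer Frechet topology. So the theorem follows from
  Kurzweil's theorem, applied to the separable normed space \<open>(X, p k)\<close> with a separating polynomial.

  Instead of complexifying \<open>X\<close>, analyticity is controlled by a weighted \<open>l\<^sub>1\<close>-norm of Taylor
  coefficients: \<open>majorant x r F M\<close> says that near \<open>x\<close> the map \<open>F\<close> is a sum of \<open>n\<close>-linear forms with
  bounds \<open>c n\<close> and \<open>(\<Sum>n. c n * r ^ n) \<le> M\<close>. These norms are submultiplicative and countably
  subadditive, so the calculus of a commutative Banach algebra is available
  (\<open>majorant_suminf\<close>, \<open>majorant_scaleR\<close>, \<open>majorant_exp\<close>, \<open>majorant_inverse\<close>). Its decisive
  feature is \<open>majorant_exp\<close>: if \<open>F - F x\<close> has norm at most \<open>d\<close>, then \<open>exp F\<close> has norm at most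
  \<open>exp (F x + d)\<close>, so a very small exponential stays very small on a whole neighbourhood.

  The squares of the homogeneous parts of the separating polynomial add up to a polynomial \<open>Q\<close>
  that is bounded away from zero outside every ball about the origin. Scaled copies of \<open>Q\<close> centred
  at the points \<open>a j\<close> of a dense sequence yield coordinates \<open>u j = exp (- \<mu> j * Q (x - a j))\<close> with
  values in \<open>[0, 1]\<close> that determine the topology, and whose oscillation near a point is summable
  over \<open>j\<close> in the above norm (\<open>separating_coordinates\<close>).

  Measure the distance of two points by their first coordinates, \<open>d n x z\<close>. Let \<open>W n\<close> be the set of
  points \<open>x\<close> such that \<open>f\<close> varies by at most \<open>e\<close> on the \<open>d n\<close>-ball of radius \<open>3 * \<rho> n\<close> about \<open>x\<close>,
  where \<open>\<rho> n = 2\<^sup>-\<^sup>n\<close>. These sets cover \<open>X\<close>. Coordinates being bounded, the part of \<open>W n\<close> outside the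
  earlier \<open>W m\<close> has a finite \<open>\<rho> n\<close>-net \<open>Z n\<close> for \<open>d n\<close>. The approximation is the weighted mean of
  the values \<open>f z\<close>, for \<open>z\<close> in some \<open>Z n\<close>, with the Gaussian weights
  \<open>exp (a n * (4 * (\<rho> n)\<^sup>2 - (d n x z)\<^sup>2))\<close> and \<open>a n\<close> growing fast. At a given \<open>x\<close> one weight is
  huge; the weights of points \<open>z\<close> at which \<open>f\<close> is far from \<open>f x\<close> are tiny, as \<open>d n x z > 3 * \<rho> n\<close>
  there; and a point of \<open>W m\<close> has \<open>d n\<close>-distance at least \<open>\<rho> m\<close> from \<open>Z n\<close> for all \<open>n \<ge> m + 2\<close>,
  a bound independent of \<open>n\<close>. The last fact, together with the stability of small exponentials, makes
  the sums of weights converge in the majorant norm (\<open>analytic_approximation\<close>).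
\<close>

section \<open>Multilinear forms and polarization\<close>

lemma n_linear_Suc:
  "n_linear (Suc n) B \<longleftrightarrow>
     (\<forall>a. n_linear n (\<lambda>l. B (a # l))) \<and> (\<forall>l. length l = n \<longrightarrow> linear (\<lambda>a. B (a # l)))"
proof (intro iffI conjI allI impI)
  assume B: "n_linear (Suc n) B"
  show "n_linear n (\<lambda>l. B (a # l))" for a
    unfolding n_linear_def
  proof (intro allI impI)
    fix xs :: "'a list" and i assume "length xs = n" "i < n"
    then have "linear (\<lambda>z. B ((a # xs)[Suc i := z]))"
      using B unfolding n_linear_def by (metis Suc_less_eq length_Cons)
    then show "linear (\<lambda>z. B (a # xs[i := z]))" by simp
  qed
  show "linear (\<lambda>a. B (a # l))" if "length l = n" for l
  proof -
    have "linear (\<lambda>z. B ((undefined # l)[0 := z]))"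
      using B that unfolding n_linear_def by (metis length_Cons zero_less_Suc)
    then show ?thesis by simp
  qed
next
  assume B: "(\<forall>a. n_linear n (\<lambda>l. B (a # l))) \<and> (\<forall>l. length l = n \<longrightarrow> linear (\<lambda>a. B (a # l)))"
  show "n_linear (Suc n) B"
    unfolding n_linear_def
  proof (intro allI impI)
    fix xs :: "'a list" and i assume xs: "length xs = Suc n" and i: "i < Suc n"
    then obtain a l where al: "xs = a # l" "length l = n" by (cases xs) auto
    show "linear (\<lambda>z. B (xs[i := z]))"
    proof (cases i)
      case 0
      then show ?thesis using B al by simp
    next
      case (Suc j)
      then have "linear (\<lambda>z. B (a # l[j := z]))"
        using B al i unfolding n_linear_def by simp
      then show ?thesis using Suc al by simp
    qed
  qed
qed

lemma n_linear_0 [simp]: "n_linear 0 B"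
  by (simp add: n_linear_def)

lemma n_linear_zero [simp]: "n_linear n (\<lambda>_. 0)"
  by (auto simp: n_linear_def intro!: linearI)

lemma n_linear_add:
  "n_linear n B \<Longrightarrow> n_linear n C \<Longrightarrow> n_linear n (\<lambda>l. B l + C l)"
  by (simp add: n_linear_def linear_compose_add)

lemma n_linear_scaleR: "n_linear n B \<Longrightarrow> n_linear n (\<lambda>l. c *\<^sub>R B l)"
  by (simp add: n_linear_def linear_compose_scale_right)

lemma n_linear_sum: "(\<And>i. i \<in> I \<Longrightarrow> n_linear n (B i)) \<Longrightarrow> n_linear n (\<lambda>l. \<Sum>i\<in>I. B i l)"
  by (simp add: n_linear_def linear_compose_sum)

text \<open>
  The part of \<open>B (z + h, ..., z + h)\<close> of degree \<open>k\<close> in \<open>h\<close>, as a \<open>k\<close>-linear form in separate arguments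
  \<open>h\<^sub>1, ..., h\<^sub>k\<close> (which are the list entries): the sum over all ways to put them, in order, into
  \<open>k\<close> of the \<open>n\<close> argument places, with \<open>z\<close> in the others. The recursion decides on the first place.
\<close>
fun shift_form :: "nat \<Rightarrow> 'a::real_vector \<Rightarrow> ('a list \<Rightarrow> 'b::real_vector) \<Rightarrow> 'a list \<Rightarrow> 'b" where
  "shift_form n z B [] = B (replicate n z)"
| "shift_form 0 z B (h # hs) = 0"
| "shift_form (Suc n) z B (h # hs) =
     shift_form n z (\<lambda>l. B (z # l)) (h # hs) + shift_form n z (\<lambda>l. B (h # l)) hs"

lemma shift_form_eq_0: "n < length hs \<Longrightarrow> shift_form n z B hs = 0"
proof (induction n arbitrary: B hs)
  case 0
  then show ?case by (cases hs) auto
next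
  case (Suc n)
  then show ?case by (cases hs) auto
qed

lemma linear_shift_form:
  "(\<And>l. length l = n \<Longrightarrow> linear (\<lambda>a. C a l)) \<Longrightarrow> linear (\<lambda>a. shift_form n z (C a) hs)"
proof (induction n arbitrary: C hs)
  case 0
  then show ?case by (cases hs) (auto intro!: linearI)
next
  case (Suc n)
  show ?case
  proof (cases hs)
    case Nil
    then show ?thesis using Suc.prems by simp
  next
    case (Cons h t)
    have "linear (\<lambda>a. shift_form n z (\<lambda>l. C a (z # l)) (h # t))"
      "linear (\<lambda>a. shift_form n z (\<lambda>l. C a (h # l)) t)"
      using Suc.prems by (auto intro!: Suc.IH)
    then show ?thesis using Cons by (simp add: linear_compose_add)
  qed
qed

lemma n_linear_shift_form: "n_linear n B \<Longrightarrow> n_linear k (shift_form n z B)"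
proof (induction n arbitrary: k B)
  case 0
  have "n_linear (Suc k) (shift_form 0 z B)" for k
    unfolding n_linear_Suc by (auto intro!: linearI)
  then show ?case by (cases k) auto
next
  case (Suc n)
  show ?case
  proof (cases k)
    case 0
    then show ?thesis by simp
  next
    case (Suc k')
    have B: "n_linear n (\<lambda>l. B (a # l))" "length l = n \<Longrightarrow> linear (\<lambda>a. B (a # l))" for a l
      using Suc.prems by (auto simp: n_linear_Suc)
    have "n_linear (Suc k') (shift_form n z (\<lambda>l. B (z # l)))"
      by (rule Suc.IH[OF B(1)])
    then have 1: "n_linear k' (\<lambda>t. shift_form n z (\<lambda>l. B (z # l)) (a # t))"
      "length t = k' \<Longrightarrow> linear (\<lambda>a. shift_form n z (\<lambda>l. B (z # l)) (a # t))" for a t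
      by (auto simp: n_linear_Suc)
    have 2: "n_linear k' (shift_form n z (\<lambda>l. B (a # l)))" for a
      by (rule Suc.IH[OF B(1)])
    have 3: "linear (\<lambda>a. shift_form n z (\<lambda>l. B (a # l)) t)" for t
      using B(2) by (rule linear_shift_form)
    show ?thesis
      unfolding \<open>k = Suc k'\<close> n_linear_Suc
      using 1 2 3 by (simp add: n_linear_add linear_compose_add)
  qed
qed

lemma sum_shift_form:
  "n_linear n B \<Longrightarrow> (\<Sum>k\<le>n. shift_form n z B (replicate k h)) = B (replicate n (z + h))"
proof (induction n arbitrary: B)
  case 0
  then show ?case by simp
next
  case (Suc n)
  have B: "n_linear n (\<lambda>l. B (a # l))" "length l = n \<Longrightarrow> linear (\<lambda>a. B (a # l))" for a l
    using Suc.prems by (auto simp: n_linear_Suc)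
  let ?z = "\<lambda>k. shift_form n z (\<lambda>l. B (z # l)) (replicate k h)"
  let ?h = "\<lambda>k. shift_form n z (\<lambda>l. B (h # l)) (replicate k h)"
  have "(\<Sum>k\<le>Suc n. shift_form (Suc n) z B (replicate k h)) = ?z 0 + (\<Sum>k\<le>n. ?z (Suc k) + ?h k)"
    by (subst sum.atMost_Suc_shift) simp
  also have "\<dots> = (\<Sum>k\<le>Suc n. ?z k) + (\<Sum>k\<le>n. ?h k)"
    by (subst sum.atMost_Suc_shift) (simp add: sum.distrib)
  also have "(\<Sum>k\<le>Suc n. ?z k) = (\<Sum>k\<le>n. ?z k)"
    by (simp add: shift_form_eq_0 del: replicate_Suc)
  also have "(\<Sum>k\<le>n. ?z k) + (\<Sum>k\<le>n. ?h k)
      = B (z # replicate n (z + h)) + B (h # replicate n (z + h))"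
    using Suc.IH[OF B(1)] by simp
  also have "\<dots> = B (replicate (Suc n) (z + h))"
    using linear_add[OF B(2)] by simp
  finally show ?case .
qed

lemma multilinear_sum:
  assumes "finite A"
  shows "n_linear n B \<Longrightarrow> B (replicate n (\<Sum>i\<in>A. v i))
    = (\<Sum>ks\<in>{ks. set ks \<subseteq> A \<and> length ks = n}. B (map v ks))"
proof (induction n arbitrary: B)
  case 0
  have "{ks. set ks \<subseteq> A \<and> length ks = 0} = {[]}" by auto
  then show ?case by simp
next
  case (Suc n)
  let ?L = "{ks. set ks \<subseteq> A \<and> length ks = n}"
  have B: "n_linear n (\<lambda>l. B (a # l))" "length l = n \<Longrightarrow> linear (\<lambda>a. B (a # l))" for a l
    using Suc.prems by (auto simp: n_linear_Suc)
  have "B (replicate (Suc n) (\<Sum>i\<in>A. v i)) = (\<Sum>i\<in>A. B (v i # replicate n (\<Sum>i\<in>A. v i)))"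
    using linear_sum[OF B(2), of "replicate n (\<Sum>i\<in>A. v i)" v A] by simp
  also have "\<dots> = (\<Sum>i\<in>A. \<Sum>ks\<in>?L. B (v i # map v ks))"
    using Suc.IH[OF B(1)] by simp
  also have "\<dots> = (\<Sum>(ks,i)\<in>?L \<times> A. B (map v (i # ks)))"
    by (subst sum.swap) (simp add: sum.cartesian_product)
  also have "\<dots> = (\<Sum>ks\<in>{ks. set ks \<subseteq> A \<and> length ks = Suc n}. B (map v ks))"
    unfolding lists_length_Suc_eq
    by (subst sum.reindex) (auto simp: inj_on_def case_prod_unfold)
  finally show ?case .
qed

text \<open>
  Inclusion-exclusion; in the polarization formula it removes all index lists that miss an index.
\<close>
lemma alternating_sum_supersets:
  assumes "K \<subseteq> N" "finite N"
  shows "(\<Sum>A | A \<subseteq> N \<and> K \<subseteq> A. (-1) ^ card A) = (if K = N then (-1) ^ card N else 0 :: real)"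
proof (cases "K = N")
  case True
  then have "{A. A \<subseteq> N \<and> K \<subseteq> A} = {N}" by auto
  then show ?thesis using True by simp
next
  case False
  have "(\<Sum>A | A \<subseteq> N \<and> K \<subseteq> A. (-1) ^ card A) = (0::real)"
  proof (rule sum_alternating_cancels)
    show "finite {A. A \<subseteq> N \<and> K \<subseteq> A}" using assms by simp
    show "card {x \<in> {A. A \<subseteq> N \<and> K \<subseteq> A}. even (card x)} = card {x \<in> {A. A \<subseteq> N \<and> K \<subseteq> A}. odd (card x)}"
      using card_subsupersets_even_odd[of N K] assms False by (simp add: conj_assoc psubset_eq)
  qed
  then show ?thesis using False by simp
qed

text \<open>
  The polarization formula expresses the symmetric form of \<open>P\<close> through values of \<open>P\<close> alone. A bound
  on \<open>P\<close> therefore bounds the form, although the form through which \<open>P\<close> was given may be unbounded.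
\<close>
definition polar :: "nat \<Rightarrow> ('a::real_vector \<Rightarrow> 'b::real_vector) \<Rightarrow> 'a list \<Rightarrow> 'b" where
  "polar n P xs = (1 / fact n) *\<^sub>R
     (\<Sum>A\<in>Pow {..<n}. (-1) ^ (n + card A) *\<^sub>R P (\<Sum>i\<in>A. xs ! i))"

text \<open>
  Expanding multilinearly gives index lists of length \<open>n\<close>; only those that contain every index
  survive the alternating sum, and these are the permutations. So \<open>polar\<close> is the symmetrization.
\<close>
lemma polar_eq_sum_perms:
  assumes B: "n_linear n B"
  shows "polar n (\<lambda>x. B (replicate n x)) xs
     = (1 / fact n) *\<^sub>R (\<Sum>ks | set ks = {..<n} \<and> length ks = n. B (map ((!) xs) ks))"
proof -
  let ?L = "{ks. set ks \<subseteq> {..<n} \<and> length ks = n}"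
  have fin: "finite ?L" by (rule finite_lists_length_eq) simp
  have "(\<Sum>A\<in>Pow {..<n}. (-1) ^ (n + card A) *\<^sub>R B (replicate n (\<Sum>i\<in>A. xs ! i)))
      = (\<Sum>A\<in>Pow {..<n}. \<Sum>ks | ks \<in> ?L \<and> set ks \<subseteq> A. (-1) ^ (n + card A) *\<^sub>R B (map ((!) xs) ks))"
  proof (rule sum.cong[OF refl])
    fix A assume A: "A \<in> Pow {..<n}"
    have "{ks. set ks \<subseteq> A \<and> length ks = n} = {ks. ks \<in> ?L \<and> set ks \<subseteq> A}" using A by auto
    moreover have "finite A" using A finite_subset by auto
    ultimately show "(-1) ^ (n + card A) *\<^sub>R B (replicate n (\<Sum>i\<in>A. xs ! i))
       = (\<Sum>ks | ks \<in> ?L \<and> set ks \<subseteq> A. (-1) ^ (n + card A) *\<^sub>R B (map ((!) xs) ks))"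
      using multilinear_sum[OF _ B, of A "(!) xs"] by (simp only: scaleR_right.sum)
  qed
  also have "\<dots> = (\<Sum>ks\<in>?L. \<Sum>A | A \<in> Pow {..<n} \<and> set ks \<subseteq> A. (-1) ^ (n + card A) *\<^sub>R B (map ((!) xs) ks))"
    by (rule sum.swap_restrict) (use fin in auto)
  also have "\<dots> = (\<Sum>ks\<in>?L. if set ks = {..<n} then B (map ((!) xs) ks) else 0)"
  proof (rule sum.cong[OF refl])
    fix ks assume "ks \<in> ?L"
    then have "(\<Sum>A | A \<subseteq> {..<n} \<and> set ks \<subseteq> A. (-1) ^ card A) = (if set ks = {..<n} then (-1) ^ n else 0 :: real)"
      using alternating_sum_supersets[of "set ks" "{..<n}"] by simp
    then have "(\<Sum>A | A \<in> Pow {..<n} \<and> set ks \<subseteq> A. (-1) ^ (n + card A)) = (if set ks = {..<n} then 1 else 0 :: real)"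
      by (simp only: power_add sum_distrib_left[symmetric] Pow_iff) (simp flip: power_add)
    then show "(\<Sum>A | A \<in> Pow {..<n} \<and> set ks \<subseteq> A. (-1) ^ (n + card A) *\<^sub>R B (map ((!) xs) ks))
       = (if set ks = {..<n} then B (map ((!) xs) ks) else 0)"
      by (simp only: scaleR_left.sum[symmetric]) simp
  qed
  also have "\<dots> = (\<Sum>ks | ks \<in> ?L \<and> set ks = {..<n}. B (map ((!) xs) ks))"
    by (rule sum.inter_filter[OF fin, symmetric])
  also have "{ks. ks \<in> ?L \<and> set ks = {..<n}} = {ks. set ks = {..<n} \<and> length ks = n}" by auto
  finally show ?thesis unfolding polar_def by simp
qed

lemma n_linear_polar:
  assumes B: "n_linear n B"
  shows "n_linear n (polar n (\<lambda>x. B (replicate n x)))"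
  unfolding polar_eq_sum_perms[OF B]
proof (intro n_linear_scaleR n_linear_sum)
  fix ks assume "ks \<in> {ks. set ks = {..<n} \<and> length ks = n}"
  then have ks: "set ks = {..<n}" "length ks = n" by auto
  then have "distinct ks" by (simp add: card_distinct)
  show "n_linear n (\<lambda>xs. B (map ((!) xs) ks))"
    unfolding n_linear_def
  proof (intro allI impI)
    fix xs :: "'a list" and i assume xs: "length xs = n" and i: "i < n"
    then obtain j where j: "j < n" "ks ! j = i" using ks by (metis in_set_conv_nth lessThan_iff)
    have "map ((!) (xs[i := z])) ks = (map ((!) xs) ks)[j := z]" for z
    proof (rule nth_equalityI)
      fix l assume "l < length (map ((!) (xs[i := z])) ks)"
      then have l: "l < n" using ks by simp
      have "ks ! l < n" using ks l by (metis lessThan_iff nth_mem)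
      moreover have "ks ! l = i \<longleftrightarrow> l = j"
        using \<open>distinct ks\<close> j l ks by (metis nth_eq_iff_index_eq)
      ultimately show "map ((!) (xs[i := z])) ks ! l = (map ((!) xs) ks)[j := z] ! l"
        using l ks(2) xs i j(1) by (cases "l = j") (simp_all add: j(2))
    qed simp
    then show "linear (\<lambda>z. B (map ((!) (xs[i := z])) ks))"
      using B j ks unfolding n_linear_def by simp
  qed
qed

lemma polar_diag:
  assumes B: "n_linear n B"
  shows "polar n (\<lambda>x. B (replicate n x)) (replicate n x) = B (replicate n x)"
proof -
  have eq: "{ks. set ks = {..<n} \<and> length ks = n} = {ks. length ks = n \<and> distinct ks \<and> set ks \<subseteq> {..<n}}"
  proof (intro equalityI subsetI; clarify)
    fix ks :: "nat list" assume "set ks = {..<length ks}" "n = length ks"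
    then show "length ks = length ks \<and> distinct ks \<and> set ks \<subseteq> {..<length ks}"
      by (metis card_distinct card_lessThan order_refl)
  next
    fix ks :: "nat list" assume "distinct ks" "set ks \<subseteq> {..<length ks}" "n = length ks"
    then show "set ks = {..<length ks} \<and> length ks = length ks"
      by (intro conjI card_subset_eq) (simp_all add: distinct_card)
  qed
  have card: "card {ks. set ks = {..<n} \<and> length ks = n} = fact n"
    unfolding eq by (subst card_lists_distinct_length_eq) (simp_all add: fact_prod)
  have "(\<Sum>ks | set ks = {..<n} \<and> length ks = n. B (map ((!) (replicate n x)) ks))
      = (\<Sum>ks | set ks = {..<n} \<and> length ks = n. B (replicate n x))"
  proof (rule sum.cong[OF refl])
    fix ks assume "ks \<in> {ks. set ks = {..<n} \<and> length ks = n}"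
    then have ks: "set ks = {..<n}" "length ks = n" by auto
    have "map ((!) (replicate n x)) ks = map (\<lambda>_. x) ks"
      by (rule map_cong) (simp_all add: ks)
    then show "B (map ((!) (replicate n x)) ks) = B (replicate n x)"
      by (simp add: map_replicate_const ks)
  qed
  also have "\<dots> = fact n *\<^sub>R B (replicate n x)"
    by (simp only: sum_constant_scaleR card of_nat_fact)
  finally show ?thesis
    unfolding polar_eq_sum_perms[OF B] by simp
qed

section \<open>Power series with absolutely convergent majorants\<close>

lemma double_series:
  fixes f :: "nat \<Rightarrow> nat \<Rightarrow> 'b::banach"
  assumes le: "\<And>k n. norm (f k n) \<le> b k n"
    and b: "\<And>k. summable (b k)" and bb: "summable (\<lambda>k. \<Sum>n. b k n)"
  shows "summable (\<lambda>k. f k n)" and "(\<lambda>n. \<Sum>k. f k n) sums (\<Sum>k. \<Sum>n. f k n)"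
proof -
  have b0: "0 \<le> b k n" for k n using le[of k n] norm_ge_zero order_trans by blast
  have col: "summable (\<lambda>k. norm (f k n))" for n
  proof (rule summable_comparison_test'[OF bb, of 0])
    fix k
    have "b k n \<le> (\<Sum>n. b k n)"
      using sum_le_suminf[OF b, of "{n}" k] b0 by simp
    then show "norm (norm (f k n)) \<le> (\<Sum>n. b k n)" using le[of k n] by simp
  qed
  then show "summable (\<lambda>k. f k n)" by (rule summable_norm_cancel)
  have row: "summable (\<lambda>n. norm (f k n))" for k
    by (rule summable_comparison_test'[OF b[of k], of 0]) (use le in simp)
  have inf: "((\<lambda>n. norm (f k n)) has_sum (\<Sum>n. norm (f k n))) UNIV" for k
    by (rule norm_summable_imp_has_sum) (use row in \<open>auto simp: summable_sums\<close>)
  have tot: "(\<lambda>k. \<Sum>n. norm (f k n)) summable_on UNIV"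
  proof (rule norm_summable_imp_summable_on, rule summable_comparison_test'[OF bb, of 0])
    fix k
    show "norm (norm (\<Sum>n. norm (f k n))) \<le> (\<Sum>n. b k n)"
      using suminf_le[OF le row b] suminf_nonneg[OF row] by simp
  qed
  have "(\<lambda>(k, n). f k n) abs_summable_on UNIV \<times> UNIV"
    by (intro iffD2[OF Infinite_Sum.abs_summable_on_Sigma_iff])
      (use tot inf suminf_nonneg[OF row] in \<open>auto simp: has_sum_iff\<close>)
  then have "(\<lambda>(k, n). f k n) summable_on UNIV \<times> UNIV"
    by (rule abs_summable_summable)
  then obtain S where S: "((\<lambda>(k, n). f k n) has_sum S) (UNIV \<times> UNIV)"
    by (auto simp: summable_on_def)
  have 1: "((\<lambda>n. f k n) has_sum (\<Sum>n. f k n)) UNIV" for k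
    by (rule norm_summable_imp_has_sum) (use row summable_norm_cancel[OF row] in \<open>auto simp: summable_sums\<close>)
  have 2: "((\<lambda>k. f k n) has_sum (\<Sum>k. f k n)) UNIV" for n
    by (rule norm_summable_imp_has_sum) (use col summable_norm_cancel[OF col] in \<open>auto simp: summable_sums\<close>)
  have "((\<lambda>k. \<Sum>n. f k n) has_sum S) UNIV"
    by (rule has_sum_SigmaD[OF S]) (use 1 in simp)
  then have "S = (\<Sum>k. \<Sum>n. f k n)"
    using has_sum_imp_sums sums_unique by blast
  moreover have "((\<lambda>(n, k). f k n) has_sum S) (UNIV \<times> UNIV)"
    using iffD1[OF has_sum_swap S] by (simp add: case_prod_unfold)
  then have "((\<lambda>n. \<Sum>k. f k n) has_sum S) UNIV"
    by (rule has_sum_SigmaD) (use 2 in simp)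
  ultimately show "(\<lambda>n. \<Sum>k. f k n) sums (\<Sum>k. \<Sum>n. f k n)"
    using has_sum_imp_sums by blast
qed

locale norm_fun =
  fixes p :: "'a::real_vector \<Rightarrow> real"
  assumes norm_on_space: "norm_on_space p"
begin

lemma p_nonneg [simp]: "0 \<le> p x"
  and p_eq_0 [simp]: "p x = 0 \<longleftrightarrow> x = 0"
  and p_scale: "p (t *\<^sub>R x) = \<bar>t\<bar> * p x"
  and p_triangle: "p (x + y) \<le> p x + p y"
  using norm_on_space by (auto simp: norm_on_space_def)

lemma p_0 [simp]: "p 0 = 0"
  by simp

lemma p_uminus [simp]: "p (- x) = p x"
  using p_scale[of "-1" x] by simp

lemma p_minus_commute: "p (x - y) = p (y - x)"
  using p_uminus[of "x - y"] by simp

lemma p_triangle_diff: "p (x - y) \<le> p x + p y"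
  using p_triangle[of x "- y"] by simp

definition bounded_form :: "nat \<Rightarrow> ('a list \<Rightarrow> 'b::real_normed_vector) \<Rightarrow> real \<Rightarrow> bool" where
  "bounded_form n B c \<longleftrightarrow> n_linear n B \<and> 0 \<le> c \<and>
     (\<forall>xs. length xs = n \<longrightarrow> norm (B xs) \<le> c * prod_list (map p xs))"

lemma bounded_form_diag:
  assumes "bounded_form n B c" shows "norm (B (replicate n h)) \<le> c * p h ^ n"
  using assms unfolding bounded_form_def by (metis length_replicate map_replicate prod_list_replicate)

lemma bounded_form_zero [simp]: "bounded_form n (\<lambda>_. 0) 0"
  by (simp add: bounded_form_def)

lemma bounded_form_const: "bounded_form 0 (\<lambda>_. v) (norm v)"
  by (simp add: bounded_form_def)

lemma prod_list_p_nonneg [simp]: "0 \<le> prod_list (map p xs)"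
  by (induction xs) auto

lemma bounded_form_mult:
  fixes A :: "'a list \<Rightarrow> real" and D :: "'a list \<Rightarrow> 'b::real_normed_vector"
  assumes A: "bounded_form i A a" and D: "bounded_form j D d"
  shows "bounded_form (i + j) (\<lambda>l. A (take i l) *\<^sub>R D (drop i l)) (a * d)"
  unfolding bounded_form_def
proof (intro conjI allI impI)
  show "n_linear (i + j) (\<lambda>l. A (take i l) *\<^sub>R D (drop i l))"
    unfolding n_linear_def
  proof (intro allI impI)
    fix xs :: "'a list" and l assume xs: "length xs = i + j" and l: "l < i + j"
    show "linear (\<lambda>z. A (take i (xs[l := z])) *\<^sub>R D (drop i (xs[l := z])))"
    proof (cases "l < i")
      case True
      have "linear (\<lambda>z. A ((take i xs)[l := z]))"
        using A True xs by (simp add: bounded_form_def n_linear_def)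
      then show ?thesis
        using True by (intro linearI)
          (simp_all add: take_update_swap linear_add[OF \<open>linear _\<close>] linear_scale[OF \<open>linear _\<close>] scaleR_add_left)
    next
      case False
      have "linear (\<lambda>z. D ((drop i xs)[l - i := z]))"
        using D False l xs by (simp add: bounded_form_def n_linear_def)
      then show ?thesis
        using False by (simp add: drop_update_swap linear_compose_scale_right)
    qed
  qed
  show "0 \<le> a * d" using A D by (simp add: bounded_form_def)
  fix xs :: "'a list" assume xs: "length xs = i + j"
  have "prod_list (map p xs) = prod_list (map p (take i xs)) * prod_list (map p (drop i xs))"
    by (metis append_take_drop_id map_append prod_list.append)
  moreover have "\<bar>A (take i xs)\<bar> * norm (D (drop i xs))
      \<le> (a * prod_list (map p (take i xs))) * (d * prod_list (map p (drop i xs)))"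
    using A D xs by (intro mult_mono) (auto simp: bounded_form_def)
  ultimately show "norm (A (take i xs) *\<^sub>R D (drop i xs)) \<le> a * d * prod_list (map p xs)"
    by (simp add: mult_ac)
qed

text \<open>
  The bounds are imposed on multilinear forms and not on the homogeneous polynomials, since sums of
  forms converge as soon as their bounds do, and the limits are again multilinear.
\<close>
definition majorant :: "'a \<Rightarrow> real \<Rightarrow> ('a \<Rightarrow> 'b::real_normed_vector) \<Rightarrow> real \<Rightarrow> bool" where
  "majorant x r F M \<longleftrightarrow> 0 < r \<and> (\<exists>B c.
     (\<forall>n. bounded_form n (B n) (c n)) \<and>
     (\<forall>h. p h \<le> r \<longrightarrow> (\<lambda>n. B n (replicate n h)) sums F (x + h)) \<and>
     summable (\<lambda>n. c n * r ^ n) \<and> (\<Sum>n. c n * r ^ n) \<le> M)"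

lemma majorantE:
  assumes "majorant x r F M"
  obtains B c where "0 < r" "\<forall>n. bounded_form n (B n) (c n)"
    "\<forall>h. p h \<le> r \<longrightarrow> (\<lambda>n. B n (replicate n h)) sums F (x + h)"
    "\<forall>n. 0 \<le> c n" "summable (\<lambda>n. c n * r ^ n)" "(\<Sum>n. c n * r ^ n) \<le> M"
proof -
  obtain B c where *: "0 < r" "\<forall>n. bounded_form n (B n) (c n)"
    "\<forall>h. p h \<le> r \<longrightarrow> (\<lambda>n. B n (replicate n h)) sums F (x + h)"
    "summable (\<lambda>n. c n * r ^ n)" "(\<Sum>n. c n * r ^ n) \<le> M"
    using assms unfolding majorant_def by auto
  then have "\<forall>n. 0 \<le> c n" by (simp add: bounded_form_def)
  with * show thesis by (intro that[of B c])
qed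

lemma form_term_le:
  assumes "bounded_form n B c" "p h \<le> r"
  shows "norm (B (replicate n h)) \<le> c * r ^ n"
proof -
  have "0 \<le> c" using assms(1) by (simp add: bounded_form_def)
  then have "c * p h ^ n \<le> c * r ^ n"
    using assms(2) by (intro mult_left_mono power_mono) auto
  then show ?thesis using bounded_form_diag[OF assms(1), of h] by linarith
qed

lemma majorant_le: "majorant x r F M \<Longrightarrow> M \<le> M' \<Longrightarrow> majorant x r F M'"
  unfolding majorant_def by (meson order_trans)

lemma majorant_nonneg:
  assumes "majorant x r F M" shows "0 \<le> M"
proof -
  from assms obtain B c where m0: "0 < r" "\<forall>n. bounded_form n (B n) (c n)"
    "\<forall>h. p h \<le> r \<longrightarrow> (\<lambda>n. B n (replicate n h)) sums F (x + h)"
    "\<forall>n. 0 \<le> c n" "summable (\<lambda>n. c n * r ^ n)" "(\<Sum>n. c n * r ^ n) \<le> M"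
    by (rule majorantE)
  note m = m0[rule_format]
  have "0 \<le> (\<Sum>n. c n * r ^ n)"
    using m(1,4,5) by (intro suminf_nonneg) auto
  then show ?thesis using m(6) by linarith
qed

lemma majorant_norm_le:
  fixes F :: "'a \<Rightarrow> 'b::banach"
  assumes "majorant x r F M" "p h \<le> r" shows "norm (F (x + h)) \<le> M"
proof -
  from assms(1) obtain B c where m0: "0 < r" "\<forall>n. bounded_form n (B n) (c n)"
    "\<forall>h. p h \<le> r \<longrightarrow> (\<lambda>n. B n (replicate n h)) sums F (x + h)"
    "\<forall>n. 0 \<le> c n" "summable (\<lambda>n. c n * r ^ n)" "(\<Sum>n. c n * r ^ n) \<le> M"
    by (rule majorantE)
  note m = m0[rule_format]
  have le: "norm (B n (replicate n h)) \<le> c n * r ^ n" for n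
    by (rule form_term_le[OF m(2) assms(2)])
  have "norm (F (x + h)) = norm (\<Sum>n. B n (replicate n h))"
    using m(3)[OF assms(2)] by (simp add: sums_iff)
  also have "\<dots> \<le> (\<Sum>n. c n * r ^ n)"
    by (rule norm_suminf_le[OF le m(5)])
  finally show ?thesis using m(6) by linarith
qed

lemma majorant_form:
  assumes B: "bounded_form n B c" and r: "0 < r"
  shows "majorant x r (\<lambda>y. B (replicate n (y - x))) (c * r ^ n)"
  unfolding majorant_def
proof (intro conjI exI allI impI)
  show "0 < r" by (rule r)
  show "bounded_form k (if k = n then B else (\<lambda>_. 0)) (if k = n then c else 0)" for k
    using B by simp
  show "(\<lambda>k. (if k = n then B else (\<lambda>_. 0)) (replicate k h)) sums B (replicate n (x + h - x))" for h
    by (rule iffD1[OF sums_cong sums_single[of n "\<lambda>k. B (replicate k (x + h - x))"]]) auto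
  have s: "(\<lambda>k. (if k = n then c else 0) * r ^ k) sums (c * r ^ n)"
    using sums_single[of n "\<lambda>k. c * r ^ k"]
    by (rule iffD1[OF sums_cong, rotated]) auto
  then show "summable (\<lambda>k. (if k = n then c else 0) * r ^ k)"
    "(\<Sum>k. (if k = n then c else 0) * r ^ k) \<le> c * r ^ n"
    by (auto simp: sums_iff)
qed

lemma majorant_const: "0 < r \<Longrightarrow> majorant x r (\<lambda>_. v) (norm v)"
  using majorant_form[OF bounded_form_const, of r x v] by simp

text \<open>
  Completeness of the algebra of power series: a countable family whose norms are summable may be
  added coefficient by coefficient. Products, exponentials and reciprocals all reduce to this.
\<close>
lemma majorant_suminf:
  fixes F :: "nat \<Rightarrow> 'a \<Rightarrow> 'b::banach"
  assumes F: "\<And>k. majorant x r (F k) (M k)" and M: "summable M"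
    and G: "\<And>h. p h \<le> r \<Longrightarrow> G (x + h) = (\<Sum>k. F k (x + h))"
  shows "majorant x r G (\<Sum>k. M k)"
proof -
  have "\<forall>k. \<exists>B c. (\<forall>n. bounded_form n (B n) (c n)) \<and>
     (\<forall>h. p h \<le> r \<longrightarrow> (\<lambda>n. B n (replicate n h)) sums F k (x + h)) \<and>
     summable (\<lambda>n. c n * r ^ n) \<and> (\<Sum>n. c n * r ^ n) \<le> M k"
    using F unfolding majorant_def by simp
  from choice[OF this] obtain B where "\<forall>k. \<exists>c. (\<forall>n. bounded_form n (B k n) (c n)) \<and>
     (\<forall>h. p h \<le> r \<longrightarrow> (\<lambda>n. B k n (replicate n h)) sums F k (x + h)) \<and>
     summable (\<lambda>n. c n * r ^ n) \<and> (\<Sum>n. c n * r ^ n) \<le> M k" ..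
  from choice[OF this] obtain c where *: "\<forall>k. (\<forall>n. bounded_form n (B k n) (c k n)) \<and>
     (\<forall>h. p h \<le> r \<longrightarrow> (\<lambda>n. B k n (replicate n h)) sums F k (x + h)) \<and>
     summable (\<lambda>n. c k n * r ^ n) \<and> (\<Sum>n. c k n * r ^ n) \<le> M k" ..
  have form: "bounded_form n (B k n) (c k n)"
    and sums: "p h \<le> r \<Longrightarrow> (\<lambda>n. B k n (replicate n h)) sums F k (x + h)"
    and summ: "summable (\<lambda>n. c k n * r ^ n)" and le: "(\<Sum>n. c k n * r ^ n) \<le> M k" for k n h
    using * by simp_all
  have r: "0 < r" using F by (auto simp: majorant_def)
  have c0: "0 \<le> c k n" for k n using form by (simp add: bounded_form_def)
  have M': "summable (\<lambda>k. \<Sum>n. c k n * r ^ n)"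
  proof (rule summable_comparison_test'[OF M, of 0])
    show "norm (\<Sum>n. c k n * r ^ n) \<le> M k" for k
      using suminf_nonneg[OF summ, of k] c0 r le[of k] by simp
  qed
  have nc: "norm (c k n * r ^ n) \<le> c k n * r ^ n" for k n using c0 r by simp
  have colr: "summable (\<lambda>k. c k n * r ^ n)" for n
    by (rule double_series(1)[OF nc summ M'])
  then have col: "summable (\<lambda>k. c k n)" for n
    using summable_mult2[OF colr[of n], of "inverse (r ^ n)"] r by (simp add: mult.assoc)
  have tot: "(\<lambda>n. \<Sum>k. c k n * r ^ n) sums (\<Sum>k. \<Sum>n. c k n * r ^ n)"
    by (rule double_series(2)[OF nc summ M'])
  have eq: "(\<Sum>k. c k n * r ^ n) = (\<Sum>k. c k n) * r ^ n" for n
    using suminf_mult2[OF col[of n], of "r ^ n"] by simp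
  have Bs: "summable (\<lambda>k. B k n xs)" "norm (\<Sum>k. B k n xs) \<le> (\<Sum>k. c k n) * prod_list (map p xs)"
    if "length xs = n" for n xs
  proof -
    have 1: "norm (B k n xs) \<le> c k n * prod_list (map p xs)" for k
      using form that by (simp add: bounded_form_def)
    have 2: "summable (\<lambda>k. c k n * prod_list (map p xs))"
      using col by (rule summable_mult2)
    show "summable (\<lambda>k. B k n xs)"
      by (rule summable_comparison_test'[OF 2, of 0]) (use 1 in simp)
    show "norm (\<Sum>k. B k n xs) \<le> (\<Sum>k. c k n) * prod_list (map p xs)"
      using norm_suminf_le[OF 1 2] suminf_mult2[OF col] by simp
  qed
  have lin: "n_linear n (\<lambda>xs. \<Sum>k. B k n xs)" for n
    unfolding n_linear_def
  proof (intro allI impI)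
    fix xs :: "'a list" and i assume xs: "length xs = n" and i: "i < n"
    have l: "linear (\<lambda>z. B k n (xs[i := z]))" for k
      using form xs i by (simp add: bounded_form_def n_linear_def)
    have s: "summable (\<lambda>k. B k n (xs[i := z]))" for z
      by (rule Bs(1)) (simp add: xs)
    show "linear (\<lambda>z. \<Sum>k. B k n (xs[i := z]))"
      using s by (intro linearI)
        (simp_all add: linear_add[OF l] linear_scale[OF l] suminf_add suminf_scaleR_right)
  qed
  show ?thesis
    unfolding majorant_def
  proof (intro conjI exI allI impI)
    show "0 < r" by (rule r)
    show "bounded_form n (\<lambda>xs. \<Sum>k. B k n xs) (\<Sum>k. c k n)" for n
      unfolding bounded_form_def using lin[of n] Bs(2) suminf_nonneg[OF col[of n]] c0 by blast
    show "summable (\<lambda>n. (\<Sum>k. c k n) * r ^ n)"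
      using tot unfolding eq by (simp add: sums_iff)
    show "(\<Sum>n. (\<Sum>k. c k n) * r ^ n) \<le> suminf M"
      using tot suminf_le[OF le M' M] unfolding eq by (simp add: sums_iff)
    fix h assume h: "p h \<le> r"
    have "norm (B k n (replicate n h)) \<le> c k n * r ^ n" for k n
      by (rule form_term_le[OF form h])
    from double_series(2)[OF this summ M']
    have "(\<lambda>n. \<Sum>k. B k n (replicate n h)) sums (\<Sum>k. \<Sum>n. B k n (replicate n h))" .
    also have "(\<Sum>k. \<Sum>n. B k n (replicate n h)) = G (x + h)"
      using sums[OF h] G[OF h] by (simp add: sums_iff)
    finally show "(\<lambda>n. \<Sum>k. B k n (replicate n h)) sums G (x + h)" .
  qed
qed

lemma majorant_add:
  fixes F G :: "'a \<Rightarrow> 'b::banach"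
  assumes F: "majorant x r F M" and G: "majorant x r G N"
  shows "majorant x r (\<lambda>y. F y + G y) (M + N)"
proof -
  have r: "0 < r" using F by (simp add: majorant_def)
  define H where "H = (\<lambda>k::nat. if k = 0 then F else if k = 1 then G else (\<lambda>_. 0))"
  define L where "L = (\<lambda>k::nat. if k = 0 then M else if k = 1 then N else 0)"
  have L: "L sums (M + N)"
    using sums_finite[of "{0, 1}" L] by (auto simp: L_def)
  have "majorant x r (H k) (L k)" for k
    using F G majorant_const[OF r, of x 0] by (auto simp: H_def L_def)
  moreover have "F y + G y = (\<Sum>k. H k y)" for y
  proof -
    have "(\<lambda>k. H k y) sums (F y + G y)"
      using sums_finite[of "{0, 1}" "\<lambda>k. H k y"] by (auto simp: H_def)
    then show ?thesis by (simp add: sums_iff)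
  qed
  ultimately have "majorant x r (\<lambda>y. F y + G y) (suminf L)"
    using L by (intro majorant_suminf[where F = H and M = L]) (auto simp: sums_iff)
  then show ?thesis using L by (simp add: sums_iff)
qed

lemma majorant_sum:
  fixes F :: "'i \<Rightarrow> 'a \<Rightarrow> 'b::banach"
  assumes "finite I" "0 < r" "\<And>i. i \<in> I \<Longrightarrow> majorant x r (F i) (M i)"
  shows "majorant x r (\<lambda>y. \<Sum>i\<in>I. F i y) (\<Sum>i\<in>I. M i)"
  using assms(1,3)
proof (induction I rule: finite_induct)
  case empty
  then show ?case using majorant_const[OF assms(2), of x 0] by simp
next
  case (insert i I)
  then show ?case by (simp add: majorant_add)
qed

text \<open>
  The product is a double sum of products of two forms, and each of those is a form again; summing
  first over one index and then over the other avoids any rearrangement.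
\<close>
lemma majorant_scaleR:
  fixes F :: "'a \<Rightarrow> real" and G :: "'a \<Rightarrow> 'b::banach"
  assumes F: "majorant x r F M" and G: "majorant x r G N"
  shows "majorant x r (\<lambda>y. F y *\<^sub>R G y) (M * N)"
proof -
  from F obtain A a where A0: "0 < r" "\<forall>n. bounded_form n (A n) (a n)"
    "\<forall>h. p h \<le> r \<longrightarrow> (\<lambda>n. A n (replicate n h)) sums F (x + h)"
    "\<forall>n. 0 \<le> a n" "summable (\<lambda>n. a n * r ^ n)" "(\<Sum>n. a n * r ^ n) \<le> M"
    by (rule majorantE)
  note A = A0[rule_format]
  from G obtain D d where D0: "0 < r" "\<forall>n. bounded_form n (D n) (d n)"
    "\<forall>h. p h \<le> r \<longrightarrow> (\<lambda>n. D n (replicate n h)) sums G (x + h)"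
    "\<forall>n. 0 \<le> d n" "summable (\<lambda>n. d n * r ^ n)" "(\<Sum>n. d n * r ^ n) \<le> N"
    by (rule majorantE)
  note D = D0[rule_format]
  have ij: "majorant x r (\<lambda>y. A i (replicate i (y - x)) *\<^sub>R D j (replicate j (y - x)))
      (a i * r ^ i * (d j * r ^ j))" for i j
    using majorant_form[OF bounded_form_mult[OF A(2)[of i] D(2)[of j]] A(1), of x]
    by (simp add: power_add mult_ac)
  have i: "majorant x r (\<lambda>y. A i (replicate i (y - x)) *\<^sub>R G y) (a i * r ^ i * (\<Sum>j. d j * r ^ j))" for i
    unfolding suminf_mult[OF D(5), symmetric]
  proof (rule majorant_suminf[OF ij])
    show "summable (\<lambda>j. a i * r ^ i * (d j * r ^ j))" using D(5) by (rule summable_mult)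
    fix h assume "p h \<le> r"
    then show "A i (replicate i (x + h - x)) *\<^sub>R G (x + h)
       = (\<Sum>k. A i (replicate i (x + h - x)) *\<^sub>R D k (replicate k (x + h - x)))"
      using D(3)[of h] by (simp add: sums_iff suminf_scaleR_right[symmetric])
  qed
  have "majorant x r (\<lambda>y. F y *\<^sub>R G y) (\<Sum>i. a i * r ^ i * (\<Sum>j. d j * r ^ j))"
  proof (rule majorant_suminf[OF i])
    show "summable (\<lambda>i. a i * r ^ i * (\<Sum>j. d j * r ^ j))" using A(5) by (rule summable_mult2)
    fix h assume "p h \<le> r"
    then show "F (x + h) *\<^sub>R G (x + h) = (\<Sum>i. A i (replicate i (x + h - x)) *\<^sub>R G (x + h))"
      using A(3)[of h] by (simp add: sums_iff suminf_scaleR_left[symmetric])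
  qed
  moreover have "(\<Sum>i. a i * r ^ i * (\<Sum>j. d j * r ^ j)) \<le> M * N"
  proof -
    have "0 \<le> (\<Sum>j. d j * r ^ j)" using D(4,5) A(1) by (intro suminf_nonneg) auto
    moreover have "0 \<le> M" using F by (rule majorant_nonneg)
    ultimately show ?thesis
      unfolding suminf_mult2[OF A(5), symmetric] using A(6) D(6) by (intro mult_mono) auto
  qed
  ultimately show ?thesis by (rule majorant_le)
qed

lemma majorant_mult:
  fixes F G :: "'a \<Rightarrow> real"
  assumes "majorant x r F M" "majorant x r G N"
  shows "majorant x r (\<lambda>y. F y * G y) (M * N)"
  using majorant_scaleR[OF assms] by simp

lemma majorant_cmult:
  fixes F :: "'a \<Rightarrow> real"
  assumes "majorant x r F M"
  shows "majorant x r (\<lambda>y. t * F y) (\<bar>t\<bar> * M)"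
  using majorant_mult[OF majorant_const assms, of t] assms by (simp add: majorant_def)

lemma majorant_power:
  fixes F :: "'a \<Rightarrow> real"
  assumes "majorant x r F M"
  shows "majorant x r (\<lambda>y. F y ^ k) (M ^ k)"
proof (induction k)
  case 0
  then show ?case using majorant_const[of r x "1::real"] assms by (simp add: majorant_def)
next
  case (Suc k)
  then show ?case using majorant_mult[OF assms] by simp
qed

text \<open>
  Without its constant term, every summand \<open>c n * r ^ n\<close> gains at least the factor \<open>s / r\<close>. So the
  oscillation about the centre becomes as small as desired on small balls.
\<close>
lemma majorant_shrink:
  fixes F :: "'a \<Rightarrow> 'b::banach"
  assumes F: "majorant x r F M" and s: "0 < s" "s \<le> r"
  shows "majorant x s (\<lambda>y. F y - F x) (s / r * M)"
proof -
  from F obtain B c where B0: "0 < r" "\<forall>n. bounded_form n (B n) (c n)"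
    "\<forall>h. p h \<le> r \<longrightarrow> (\<lambda>n. B n (replicate n h)) sums F (x + h)"
    "\<forall>n. 0 \<le> c n" "summable (\<lambda>n. c n * r ^ n)" "(\<Sum>n. c n * r ^ n) \<le> M"
    by (rule majorantE)
  note B = B0[rule_format]
  have at0: "B 0 [] = F x"
  proof -
    have z: "B n (replicate n 0) = 0" if "n \<noteq> 0" for n
      using bounded_form_diag[OF B(2), of n 0] that by (simp add: power_0_left)
    have "(\<lambda>n. B n (replicate n 0)) sums (B 0 (replicate 0 0))"
      using sums_finite[of "{0}" "\<lambda>n. B n (replicate n 0)"] z by auto
    moreover have "(\<lambda>n. B n (replicate n 0)) sums F x"
      using B(3)[of 0] B(1) by simp
    ultimately show ?thesis using sums_unique2 by fastforce
  qed
  let ?c = "\<lambda>n. if n = 0 then 0 else c n"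
  have le: "?c n * s ^ n \<le> s / r * (c n * r ^ n)" for n
  proof (cases n)
    case (Suc m)
    have "s ^ m \<le> r ^ m" using s by (intro power_mono) auto
    then show ?thesis
      using Suc B(1) B(4)[of "Suc m"] s by (simp add: field_simps mult_right_mono)
  qed (use s B in auto)
  have nn: "0 \<le> ?c n * s ^ n" for n using B(4) s by simp
  have sm: "summable (\<lambda>n. s / r * (c n * r ^ n))" using B(5) by (rule summable_mult)
  have sc: "summable (\<lambda>n. ?c n * s ^ n)"
    by (rule summable_comparison_test'[OF sm, of 0]) (metis le nn abs_of_nonneg real_norm_def)
  show ?thesis
    unfolding majorant_def
  proof (intro conjI exI allI impI)
    show "0 < s" by (rule s)
    show "bounded_form n (if n = 0 then (\<lambda>_. 0) else B n) (?c n)" for n using B(2) by simp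
    show "summable (\<lambda>n. ?c n * s ^ n)" by (rule sc)
    have "(\<Sum>n. ?c n * s ^ n) \<le> (\<Sum>n. s / r * (c n * r ^ n))" by (rule suminf_le[OF le sc sm])
    also have "\<dots> = s / r * (\<Sum>n. c n * r ^ n)" by (rule suminf_mult[OF B(5)])
    also have "\<dots> \<le> s / r * M" using B(1,6) s by (intro mult_left_mono) auto
    finally show "(\<Sum>n. ?c n * s ^ n) \<le> s / r * M" .
    fix h assume "p h \<le> s"
    then have "(\<lambda>n. B n (replicate n h)) sums F (x + h)" using B(3) s by simp
    from sums_diff[OF this sums_single[of 0 "\<lambda>_. F x"]]
    show "(\<lambda>n. (if n = 0 then (\<lambda>_. 0) else B n) (replicate n h)) sums (F (x + h) - F x)"
      by (rule iffD1[OF sums_cong, rotated]) (auto simp: at0)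
  qed
qed

lemma majorant_exp_diff:
  assumes E: "majorant x r (\<lambda>y. F y - F x) d"
  shows "majorant x r (\<lambda>y. exp (F y) - exp (F x)) (exp (F x) * (exp d - 1) :: real)"
proof -
  let ?M = "\<lambda>k. exp (F x) / fact (Suc k) * d ^ Suc k"
  have ser: "(\<lambda>k. exp (F x) / fact (Suc k) * t ^ Suc k) sums (exp (F x) * (exp t - 1))" for t
  proof -
    have "(\<lambda>k. t ^ k /\<^sub>R fact k) sums exp t" by (rule exp_converges)
    then have "(\<lambda>k. t ^ Suc k /\<^sub>R fact (Suc k)) sums (exp t - 1)"
      by (subst sums_Suc_iff) simp
    from sums_mult[OF this, of "exp (F x)"] show ?thesis
      by (simp add: divide_inverse mult_ac)
  qed
  have "majorant x r (\<lambda>y. exp (F x) / fact (Suc k) * (F y - F x) ^ Suc k) (?M k)" for k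
    using majorant_cmult[OF majorant_power[OF E], of "exp (F x) / fact (Suc k)" "Suc k"] by simp
  then have "majorant x r (\<lambda>y. exp (F y) - exp (F x)) (suminf ?M)"
  proof (rule majorant_suminf)
    show "summable ?M" using ser[of d] by (simp add: sums_iff)
    fix h
    have "exp (F (x + h)) - exp (F x) = exp (F x) * (exp (F (x + h) - F x) - 1)"
      by (simp add: exp_diff field_simps)
    also have "\<dots> = (\<Sum>k. exp (F x) / fact (Suc k) * (F (x + h) - F x) ^ Suc k)"
      using ser[of "F (x + h) - F x"] by (simp add: sums_iff)
    finally show "exp (F (x + h)) - exp (F x)
      = (\<Sum>k. exp (F x) / fact (Suc k) * (F (x + h) - F x) ^ Suc k)" .
  qed
  then show ?thesis using ser[of d] by (simp add: sums_iff)
qed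

text \<open>
  The constant term enters through its sign and not through its absolute value. This is what
  replaces the bound for the real part of the exponent in a complexification.
\<close>
lemma majorant_exp:
  assumes E: "majorant x r (\<lambda>y. F y - F x) d"
  shows "majorant x r (\<lambda>y. exp (F y)) (exp (F x + d) :: real)"
proof -
  have "0 < r" using E by (simp add: majorant_def)
  from majorant_add[OF majorant_exp_diff[OF E] majorant_const[OF this, of x "exp (F x)"]]
  show ?thesis by (simp add: exp_add algebra_simps)
qed

text \<open>The Neumann series about the value at the centre.\<close>
lemma majorant_inverse:
  fixes W :: "'a \<Rightarrow> real"
  assumes E: "majorant x r (\<lambda>y. W y - W x) d" and d: "d < W x"
  shows "\<exists>M. majorant x r (\<lambda>y. inverse (W y)) M"
proof -
  have d0: "0 \<le> d" by (rule majorant_nonneg[OF E])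
  then have W: "0 < W x" using d by linarith
  let ?M = "\<lambda>k. \<bar>inverse (W x) * (- inverse (W x)) ^ k\<bar> * d ^ k"
  have "majorant x r (\<lambda>y. inverse (W x) * (- inverse (W x)) ^ k * (W y - W x) ^ k) (?M k)" for k
    by (rule majorant_cmult[OF majorant_power[OF E]])
  then have "majorant x r (\<lambda>y. inverse (W y)) (suminf ?M)"
  proof (rule majorant_suminf)
    have "?M = (\<lambda>k. inverse (W x) * (d / W x) ^ k)"
      using W by (auto simp: abs_mult power_abs divide_inverse power_mult_distrib)
    moreover have "summable (\<lambda>k. inverse (W x) * (d / W x) ^ k)"
      using d d0 W by (intro summable_mult summable_geometric) auto
    ultimately show "summable ?M" by simp
    fix h assume "p h \<le> r"
    then have "\<bar>W (x + h) - W x\<bar> \<le> d" using majorant_norm_le[OF E] by force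
    then have lt: "norm (- ((W (x + h) - W x) / W x)) < 1" using W d by (simp add: abs_div)
    have "(\<Sum>k. inverse (W x) * (- ((W (x + h) - W x) / W x)) ^ k)
       = inverse (W x) * (1 / (1 - (- ((W (x + h) - W x) / W x))))"
      by (subst suminf_mult[OF summable_geometric[OF lt]]) (simp only: suminf_geometric[OF lt])
    also have "\<dots> = inverse (W (x + h))"
      using W by (simp add: field_simps)
    also have "(\<lambda>k. inverse (W x) * (- ((W (x + h) - W x) / W x)) ^ k)
      = (\<lambda>k. inverse (W x) * (- inverse (W x)) ^ k * (W (x + h) - W x) ^ k)"
    proof
      fix k
      have "- ((W (x + h) - W x) / W x) = - inverse (W x) * (W (x + h) - W x)"
        by (simp add: divide_inverse)
      then show "inverse (W x) * (- ((W (x + h) - W x) / W x)) ^ k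
        = inverse (W x) * (- inverse (W x)) ^ k * (W (x + h) - W x) ^ k"
        by (simp only: power_mult_distrib mult.assoc)
    qed
    finally show "inverse (W (x + h))
      = (\<Sum>k. inverse (W x) * (- inverse (W x)) ^ k * (W (x + h) - W x) ^ k)" by simp
  qed
  then show ?thesis by blast
qed

lemma bounded_form_shift_form:
  "bounded_form n B c \<Longrightarrow>
    bounded_form k (shift_form n z B) (c * real (n choose k) * p z ^ (n - k))"
proof -
  have bound: "norm (shift_form n z B hs)
      \<le> c * real (n choose length hs) * p z ^ (n - length hs) * prod_list (map p hs)"
    if "bounded_form n B c" for hs
    using that
  proof (induction n arbitrary: B c hs)
    case 0
    then show ?case
      by (cases hs) (auto simp: bounded_form_def)
  next
    case (Suc n)
    have c: "0 \<le> c" using Suc.prems by (simp add: bounded_form_def)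
    have B: "bounded_form n (\<lambda>l. B (a # l)) (c * p a)" for a
    proof -
      have "norm (B (a # l)) \<le> c * prod_list (map p (a # l))" if "length l = n" for l
        using Suc.prems that unfolding bounded_form_def by (metis length_Cons)
      then show ?thesis
        using Suc.prems by (simp add: bounded_form_def n_linear_Suc mult_ac)
    qed
    show ?case
    proof (cases hs)
      case Nil
      then show ?thesis using bounded_form_diag[OF Suc.prems, of z] by simp
    next
      case (Cons h t)
      let ?k = "length t" and ?P = "p h * prod_list (map p t)"
      have P: "0 \<le> ?P" by simp
      have "norm (shift_form (Suc n) z B hs)
        \<le> c * p z * real (n choose Suc ?k) * p z ^ (n - Suc ?k) * ?P
          + c * p h * real (n choose ?k) * p z ^ (n - ?k) * prod_list (map p t)"
        using Suc.IH[OF B, of z "h # t"] Suc.IH[OF B, of h t]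
        unfolding Cons by (auto intro: order_trans[OF norm_triangle_ineq])
      also have "c * p z * real (n choose Suc ?k) * p z ^ (n - Suc ?k) * ?P
         = c * real (n choose Suc ?k) * p z ^ (n - ?k) * ?P"
      proof (cases "?k < n")
        case True
        then have "n - ?k = Suc (n - Suc ?k)" by simp
        then show ?thesis by (simp only: power_Suc) (simp add: mult_ac)
      qed simp
      finally show ?thesis
        unfolding Cons by (simp add: algebra_simps)
    qed
  qed
  assume B: "bounded_form n B c"
  then show ?thesis
    using bound[OF B] n_linear_shift_form[of n B k z] by (auto simp: bounded_form_def)
qed

text \<open>
  Expanding about another centre: the bounds of the shifted forms are the binomial coefficients of
  \<open>c * (p (x - a) + r) ^ n\<close>.
\<close>
lemma majorant_translated_form:
  assumes B: "bounded_form n B c" and r: "0 < r"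
  shows "majorant x r (\<lambda>y. B (replicate n (y - a))) (c * (p (x - a) + r) ^ n)"
  unfolding majorant_def
proof (intro conjI exI allI impI)
  let ?z = "x - a"
  show "0 < r" by (rule r)
  show "bounded_form k (shift_form n ?z B) (c * real (n choose k) * p ?z ^ (n - k))" for k
    by (rule bounded_form_shift_form[OF B])
  have "(\<lambda>k. c * real (n choose k) * p ?z ^ (n - k) * r ^ k) sums
      (\<Sum>k\<le>n. c * real (n choose k) * p ?z ^ (n - k) * r ^ k)"
    by (rule sums_finite) (auto simp: not_le)
  also have "(\<Sum>k\<le>n. c * real (n choose k) * p ?z ^ (n - k) * r ^ k) = c * (p ?z + r) ^ n"
    by (subst add.commute[of "p ?z" r]) (simp add: binomial_ring sum_distrib_left mult_ac)
  finally show "summable (\<lambda>k. c * real (n choose k) * p ?z ^ (n - k) * r ^ k)"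
    "(\<Sum>k. c * real (n choose k) * p ?z ^ (n - k) * r ^ k) \<le> c * (p ?z + r) ^ n"
    by (auto simp: sums_iff)
  fix h
  have "(\<lambda>k. shift_form n ?z B (replicate k h)) sums (\<Sum>k\<le>n. shift_form n ?z B (replicate k h))"
    by (rule sums_finite) (auto simp: not_le shift_form_eq_0)
  also have "(\<Sum>k\<le>n. shift_form n ?z B (replicate k h)) = B (replicate n (?z + h))"
    by (rule sum_shift_form) (use B in \<open>simp add: bounded_form_def\<close>)
  also have "?z + h = x + h - a" by simp
  finally show "(\<lambda>k. shift_form n ?z B (replicate k h)) sums B (replicate n (x + h - a))" .
qed

end

section \<open>Approximation by Gaussian means in bounded coordinates\<close>

text \<open>
  The squared distance must be a polynomial in the coordinates to be used in an exponent, which is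
  why the Euclidean distance is taken and not the maximum.
\<close>
definition cyl_dist :: "(nat \<Rightarrow> 'a \<Rightarrow> real) \<Rightarrow> nat \<Rightarrow> 'a \<Rightarrow> 'a \<Rightarrow> real" where
  "cyl_dist u n x z = L2_set (\<lambda>j. u j x - u j z) {..n}"

lemma cyl_dist_power2: "(cyl_dist u n x z)\<^sup>2 = (\<Sum>j\<le>n. (u j x - u j z)\<^sup>2)"
  by (simp add: cyl_dist_def L2_set_def sum_nonneg)

lemma cyl_dist_nonneg [simp]: "0 \<le> cyl_dist u n x z"
  by (simp add: cyl_dist_def)

lemma cyl_dist_self [simp]: "cyl_dist u n x x = 0"
  by (simp add: cyl_dist_def L2_set_def)

lemma cyl_dist_commute: "cyl_dist u n x z = cyl_dist u n z x"
  by (simp add: cyl_dist_def L2_set_def power2_commute)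

lemma cyl_dist_mono: "n \<le> m \<Longrightarrow> cyl_dist u n x z \<le> cyl_dist u m x z"
  unfolding cyl_dist_def L2_set_def by (intro real_sqrt_le_mono sum_mono2) auto

lemma cyl_dist_triangle: "cyl_dist u n x z \<le> cyl_dist u n x y + cyl_dist u n y z"
  using L2_set_triangle_ineq[of "\<lambda>j. u j x - u j y" "\<lambda>j. u j y - u j z" "{..n}"]
  by (simp add: cyl_dist_def)

lemma abs_diff_le_cyl_dist:
  assumes "j \<le> n" shows "\<bar>u j x - u j z\<bar> \<le> cyl_dist u n x z"
proof -
  have "(u j x - u j z)\<^sup>2 \<le> (\<Sum>j\<le>n. (u j x - u j z)\<^sup>2)"
    using assms by (intro member_le_sum) auto
  then have "\<bar>u j x - u j z\<bar>\<^sup>2 \<le> (cyl_dist u n x z)\<^sup>2"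
    by (simp add: cyl_dist_power2)
  then show ?thesis by (rule power2_le_imp_le) simp
qed

text \<open>
  The first coordinates map the space to a cube, which is cut into finitely many small cells; a net
  within the set itself picks one point from each cell that the set meets.
\<close>
lemma finite_cyl_net:
  assumes u: "\<And>j x. 0 \<le> u j x" "\<And>j x. u j x \<le> 1" and \<rho>: "0 < \<rho>"
  shows "\<exists>Z. finite Z \<and> Z \<subseteq> S \<and> (\<forall>x\<in>S. \<exists>z\<in>Z. cyl_dist u n x z \<le> \<rho>)"
proof -
  obtain M :: nat where M: "real (n + 1) / \<rho> < real M"
    using reals_Archimedean2 by blast
  have M0: "0 < real M" using M \<rho> by (smt (verit) divide_nonneg_pos of_nat_0_le_iff)
  define cell where "cell x = (\<lambda>j\<in>{..n}. nat \<lfloor>u j x * M\<rfloor>)" for x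
  have "cell ` S \<subseteq> ({..n} \<rightarrow>\<^sub>E {..M})"
  proof (intro image_subsetI PiE_I)
    fix x j assume "j \<in> {..n}"
    have "u j x * M \<le> M" using u(2)[of j x] M0 by (simp add: mult_left_le_one_le u(1))
    then have "\<lfloor>u j x * M\<rfloor> \<le> int M" by linarith
    then show "cell x j \<in> {..M}" using \<open>j \<in> {..n}\<close> by (simp add: cell_def nat_le_iff)
  qed (simp add: cell_def)
  then have fin: "finite (cell ` S)"
    by (rule finite_subset) (intro finite_PiE; simp)
  define pt where "pt c = (SOME x. x \<in> S \<and> cell x = c)" for c
  have pt: "pt (cell x) \<in> S" "cell (pt (cell x)) = cell x" if "x \<in> S" for x
    using someI[of "\<lambda>y. y \<in> S \<and> cell y = cell x" x] that by (auto simp: pt_def)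
  have near: "cyl_dist u n x (pt (cell x)) \<le> \<rho>" if "x \<in> S" for x
  proof -
    let ?z = "pt (cell x)"
    have "\<bar>u j x - u j ?z\<bar> \<le> 1 / M" if "j \<le> n" for j
    proof -
      have "cell ?z j = cell x j" using pt \<open>x \<in> S\<close> by simp
      then have "nat \<lfloor>u j x * M\<rfloor> = nat \<lfloor>u j ?z * M\<rfloor>" using that by (simp add: cell_def)
      moreover have "0 \<le> u j x * M" "0 \<le> u j ?z * M" using u(1) by auto
      ultimately have "\<lfloor>u j x * M\<rfloor> = \<lfloor>u j ?z * M\<rfloor>" by (metis eq_nat_nat_iff zero_le_floor)
      then have "\<bar>u j x * M - u j ?z * M\<bar> \<le> 1" by linarith
      then have "\<bar>u j x - u j ?z\<bar> * M \<le> 1"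
        using M0 by (simp add: left_diff_distrib[symmetric] abs_mult)
      then show ?thesis using M0 by (simp add: field_simps)
    qed
    then have "(\<Sum>j\<le>n. \<bar>u j x - u j ?z\<bar>) \<le> (\<Sum>j\<le>n. 1 / M)"
      by (intro sum_mono) auto
    also have "\<dots> = real (n + 1) / M" by simp
    also have "\<dots> \<le> \<rho>" using M M0 \<rho> by (simp add: field_simps)
    finally show ?thesis
      unfolding cyl_dist_def by (rule order_trans[OF L2_set_le_sum_abs])
  qed
  show ?thesis
  proof (intro exI conjI ballI)
    show "finite (pt ` cell ` S)" using fin by simp
    show "pt ` cell ` S \<subseteq> S" using pt(1) by auto
    show "\<exists>z\<in>pt ` cell ` S. cyl_dist u n x z \<le> \<rho>" if "x \<in> S" for x
      using near[OF that] that by (intro bexI[of _ "pt (cell x)"]) simp_all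
  qed
qed

context norm_fun
begin

lemma majorant_smaller:
  fixes F :: "'a \<Rightarrow> 'b::banach"
  assumes "majorant x r F M" "0 < s" "s \<le> r"
  shows "majorant x s F (M + norm (F x))"
proof -
  have F: "majorant x s (\<lambda>y. F y - F x + F x) (s / r * M + norm (F x))"
    by (rule majorant_add[OF majorant_shrink[OF assms] majorant_const[OF assms(2)]])
  have "s / r * M \<le> M"
    using assms majorant_nonneg[OF assms(1)] by (intro mult_left_le_one_le) auto
  then have "s / r * M + norm (F x) \<le> M + norm (F x)" by simp
  from majorant_le[OF F this] show ?thesis by simp
qed

text \<open>
  Since the coordinates lie in \<open>[0, 1]\<close> and their oscillations are summable, squared distances to a
  fixed point oscillate by an amount that depends neither on the number of coordinates nor on the
  fixed point. This uniformity gives all Gaussian weights a common radius of convergence.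
\<close>
lemma majorant_cyl_dist:
  assumes u: "\<And>j x. 0 \<le> u j x" "\<And>j x. u j x \<le> 1"
    and osc: "\<And>j. majorant x r (\<lambda>y. u j y - u j x) (\<delta> * (1/2) ^ j)"
    and \<delta>: "0 < \<delta>" "\<delta> \<le> 1"
  shows "majorant x r (\<lambda>y. (cyl_dist u n y z)\<^sup>2 - (cyl_dist u n x z)\<^sup>2) (6 * \<delta>)"
proof -
  have r: "0 < r" using osc by (simp add: majorant_def)
  have j: "majorant x r (\<lambda>y. (u j y - u j z)\<^sup>2 - (u j x - u j z)\<^sup>2) (3 * \<delta> * (1/2) ^ j)" for j
  proof -
    let ?q = "(1/2 :: real) ^ j"
    have q: "0 \<le> ?q" "?q \<le> 1" by (auto simp: power_le_one)
    have "majorant x r (\<lambda>y. (u j y - u j x) ^ 2 + 2 * (u j x - u j z) * (u j y - u j x))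
       ((\<delta> * ?q) ^ 2 + \<bar>2 * (u j x - u j z)\<bar> * (\<delta> * ?q))"
      by (rule majorant_add[OF majorant_power[OF osc] majorant_cmult[OF osc]])
    moreover have "(\<lambda>y. (u j y - u j x) ^ 2 + 2 * (u j x - u j z) * (u j y - u j x))
        = (\<lambda>y. (u j y - u j z)\<^sup>2 - (u j x - u j z)\<^sup>2)"
      by (rule ext) (simp add: power2_eq_square algebra_simps)
    moreover have "(\<delta> * ?q) ^ 2 + \<bar>2 * (u j x - u j z)\<bar> * (\<delta> * ?q) \<le> 3 * \<delta> * ?q"
    proof -
      have "(\<delta> * ?q) * (\<delta> * ?q) \<le> 1 * (\<delta> * ?q)"
        using \<delta> q mult_mono[of \<delta> 1 ?q 1] by (intro mult_right_mono) auto
      moreover have "\<bar>2 * (u j x - u j z)\<bar> \<le> 2"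
        using u(1)[of j x] u(2)[of j x] u(1)[of j z] u(2)[of j z] by (simp add: abs_mult abs_le_iff)
      then have "\<bar>2 * (u j x - u j z)\<bar> * (\<delta> * ?q) \<le> 2 * (\<delta> * ?q)"
        using \<delta> q by (intro mult_right_mono) auto
      ultimately show ?thesis by (simp add: power2_eq_square)
    qed
    ultimately show ?thesis by (simp only: majorant_le)
  qed
  have "(\<Sum>j\<le>n. 3 * \<delta> * (1/2) ^ j) \<le> 6 * \<delta>"
  proof -
    have "(\<Sum>j\<le>n. (1/2 :: real) ^ j) \<le> (\<Sum>j. (1/2) ^ j)"
      by (rule sum_le_suminf) (auto simp: summable_geometric)
    also have "\<dots> = 2" by (simp add: suminf_geometric)
    finally show ?thesis using \<delta> by (simp flip: sum_distrib_left)
  qed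
  moreover have "majorant x r (\<lambda>y. \<Sum>j\<le>n. (u j y - u j z)\<^sup>2 - (u j x - u j z)\<^sup>2) (\<Sum>j\<le>n. 3 * \<delta> * (1/2) ^ j)"
    by (rule majorant_sum) (use r j in auto)
  ultimately show ?thesis
    unfolding cyl_dist_power2 sum_subtractf[symmetric] by (rule majorant_le[rotated])
qed

lemma exp_decay_beats:
  assumes "0 < (t::real)" "0 < \<eta>" "0 \<le> S"
  shows "\<exists>a>0. exp (- (a * t)) * (1 + S) \<le> \<eta>"
proof -
  let ?a = "max 1 (ln ((1 + S) / \<eta>) / t)"
  have "ln ((1 + S) / \<eta>) \<le> ?a * t"
    using assms(1) by (simp add: pos_divide_le_eq[symmetric])
  moreover have "0 < (1 + S) / \<eta>" using assms by simp
  ultimately have "(1 + S) / \<eta> \<le> exp (?a * t)"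
    by (metis exp_le_cancel_iff exp_ln)
  then have "exp (- (?a * t)) * (1 + S) \<le> \<eta>"
    using assms by (simp add: exp_minus field_simps)
  then show ?thesis by (intro exI[of _ ?a]) auto
qed

text \<open>
  Kurzweil's theorem for a space with bounded analytic coordinates that generate its topology. The
  hypothesis \<open>osc\<close> is the analyticity of the coordinate map into \<open>l\<^sub>1\<close>, in the form in which it is
  used.
\<close>
theorem analytic_approximation:
  fixes u :: "nat \<Rightarrow> 'a \<Rightarrow> real" and f :: "'a \<Rightarrow> 'b::banach"
  assumes u: "\<And>j x. 0 \<le> u j x" "\<And>j x. u j x \<le> 1"
    and osc: "\<And>x \<delta>. 0 < \<delta> \<Longrightarrow> \<exists>r. \<forall>j. majorant x r (\<lambda>y. u j y - u j x) (\<delta> * (1/2) ^ j)"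
    and sep: "\<And>x s. 0 < s \<Longrightarrow> \<exists>j \<gamma>. 0 < \<gamma> \<and> (\<forall>z. \<bar>u j z - u j x\<bar> < \<gamma> \<longrightarrow> p (z - x) < s)"
    and cont: "\<And>x e. 0 < e \<Longrightarrow> \<exists>s>0. \<forall>z. p (z - x) < s \<longrightarrow> norm (f z - f x) < e"
    and e: "0 < e"
  shows "\<exists>H. (\<forall>x. \<exists>r M. majorant x r H M) \<and> (\<forall>x. norm (f x - H x) \<le> 2 * e)"
proof -
  define \<rho> where "\<rho> n = (1/2 :: real) ^ n" for n
  define d where "d = cyl_dist u"
  define W where "W n = {x. \<forall>z z'. d n x z \<le> 3 * \<rho> n \<and> d n x z' \<le> 3 * \<rho> n \<longrightarrow> norm (f z - f z') \<le> e}" for n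
  define A where "A n = W n - (\<Union>m<n. W m)" for n
  have \<rho>: "0 < \<rho> n" for n by (simp add: \<rho>_def)
  have cover: "\<exists>n. x \<in> W n" for x
  proof -
    obtain s where s: "0 < s" "\<And>z. p (z - x) < s \<Longrightarrow> norm (f z - f x) < e / 2"
      using cont[of "e / 2" x] e by auto
    obtain j \<gamma> where \<gamma>: "0 < \<gamma>" "\<And>z. \<bar>u j z - u j x\<bar> < \<gamma> \<Longrightarrow> p (z - x) < s"
      using sep[OF s(1), of x] by auto
    obtain k where k: "(1/2 :: real) ^ k < \<gamma> / 3"
      using real_arch_pow_inv[of "\<gamma> / 3" "1/2"] \<gamma> by auto
    define n where "n = max j k"
    have "\<rho> n \<le> (1/2) ^ k" unfolding \<rho>_def n_def by (rule power_decreasing) auto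
    then have n: "3 * \<rho> n < \<gamma>" using k by simp
    have near: "norm (f z - f x) < e / 2" if "d n x z \<le> 3 * \<rho> n" for z
    proof -
      have "\<bar>u j x - u j z\<bar> \<le> d n x z"
        unfolding d_def by (rule abs_diff_le_cyl_dist) (simp add: n_def)
      then show ?thesis using that n by (intro s(2) \<gamma>(2)) (simp add: abs_minus_commute)
    qed
    have "x \<in> W n"
      unfolding W_def
    proof (intro CollectI allI impI, elim conjE)
      fix z z' assume "d n x z \<le> 3 * \<rho> n" "d n x z' \<le> 3 * \<rho> n"
      then show "norm (f z - f z') \<le> e"
        using near[of z] near[of z'] norm_triangle_ineq4[of "f z - f x" "f z' - f x"] by simp
    qed
    then show ?thesis by blast
  qed
  \<comment> \<open>A point \<open>d m\<close>-close to \<open>x\<close> belongs to \<open>W (m + 1)\<close> because the radii halve, but \<open>A n\<close> avoids it.\<close>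
  have far: "\<rho> m < d n x z" if "x \<in> W m" "z \<in> A n" "m + 2 \<le> n" for m n x z
  proof (rule ccontr)
    assume "\<not> \<rho> m < d n x z"
    moreover have "d m x z \<le> d n x z" unfolding d_def using that by (intro cyl_dist_mono) auto
    ultimately have xz: "d m x z \<le> \<rho> m" by simp
    have "d m x z' \<le> 3 * \<rho> m" if "d (m + 1) z z' \<le> 3 * \<rho> (m + 1)" for z'
    proof -
      have "d m x z' \<le> d m x z + d m z z'" unfolding d_def by (rule cyl_dist_triangle)
      moreover have "d m z z' \<le> d (m + 1) z z'" unfolding d_def by (intro cyl_dist_mono) auto
      moreover have "\<rho> (m + 1) = \<rho> m / 2" by (simp add: \<rho>_def)
      ultimately show ?thesis using that xz \<rho>[of m] by linarith
    qed
    then have "z \<in> W (m + 1)" using \<open>x \<in> W m\<close> by (simp add: W_def)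
    moreover have "m + 1 < n" using \<open>m + 2 \<le> n\<close> by simp
    ultimately show False using \<open>z \<in> A n\<close> unfolding A_def by blast
  qed
  have "\<forall>n. \<exists>Z. finite Z \<and> Z \<subseteq> A n \<and> (\<forall>x\<in>A n. \<exists>z\<in>Z. d n x z \<le> \<rho> n)"
    unfolding d_def by (rule allI, rule finite_cyl_net[OF u \<rho>])
  from choice[OF this] obtain Z where
    "\<forall>n. finite (Z n) \<and> Z n \<subseteq> A n \<and> (\<forall>x\<in>A n. \<exists>z\<in>Z n. d n x z \<le> \<rho> n)" ..
  then have Zfin: "finite (Z n)" and ZA: "Z n \<subseteq> A n"
    and net: "\<forall>x\<in>A n. \<exists>z\<in>Z n. d n x z \<le> \<rho> n" for n by auto
  define S where "S n = (\<Sum>z\<in>Z n. 1 + norm (f z))" for n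
  have S0: "0 \<le> S n" for n unfolding S_def by (intro sum_nonneg) (simp add: add_nonneg_nonneg)
  define \<eta> where "\<eta> = e / (2 * (1 + e))"
  have \<eta>: "0 < \<eta>" "\<eta> \<le> 1" "2 * \<eta> * (1 + e) = e" using e by (auto simp: \<eta>_def field_simps)
  \<comment> \<open>\<open>a n * t n\<close> large makes bad weights small and the good one large (second entry), and it makes
     \<open>exp (- (a n * c))\<close> summable for every constant \<open>c > 0\<close>, as \<open>t n \<le> c\<close> eventually (first entry).\<close>
  define t where "t n = min (1 / real (n + 1)) (3 * (\<rho> n)\<^sup>2)" for n
  have t: "0 < t n" for n using \<rho>[of n] by (simp add: t_def)
  have "\<forall>n. \<exists>a>0. exp (- (a * t n)) * (1 + S n) \<le> \<eta> * (1/2) ^ n"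
    using exp_decay_beats[OF t _ S0] \<eta>(1) by simp
  from choice[OF this] obtain a where "\<forall>n. 0 < a n \<and> exp (- (a n * t n)) * (1 + S n) \<le> \<eta> * (1/2) ^ n" ..
  then have a: "0 < a n" "exp (- (a n * t n)) * (1 + S n) \<le> \<eta> * (1/2) ^ n" for n by auto
  have aS: "exp (- (a n * t n)) * S n \<le> \<eta> * (1/2) ^ n" for n
  proof -
    have "exp (- (a n * t n)) * S n \<le> exp (- (a n * t n)) * (1 + S n)" by simp
    then show ?thesis using a(2)[of n] by linarith
  qed
  define w where "w n z x = exp (a n * (4 * (\<rho> n)\<^sup>2 - (d n x z)\<^sup>2))" for n z x
  define g where "g n x = (\<Sum>z\<in>Z n. w n z x)" for n x
  define G where "G n x = (\<Sum>z\<in>Z n. w n z x *\<^sub>R f z)" for n x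
  have local: "\<exists>r M. summable M \<and> (\<forall>n. majorant x r (g n) (M n) \<and> majorant x r (G n) (M n))" for x
  proof -
    obtain m where m: "x \<in> W m" using cover by blast
    define \<gamma> where "\<gamma> = \<rho> m"
    have \<gamma>: "0 < \<gamma>" "\<gamma> \<le> 1" by (auto simp: \<gamma>_def \<rho>_def power_le_one)
    \<comment> \<open>With this choice squared distances oscillate by at most \<open>\<gamma>\<^sup>2 / 4\<close>, so that \<open>\<gamma>\<^sup>2 / 2\<close> remains of
       \<open>\<gamma>\<^sup>2\<close> even after another \<open>\<gamma>\<^sup>2 / 4\<close> is lost to \<open>4 * (\<rho> n)\<^sup>2\<close>.\<close>
    define \<delta> where "\<delta> = \<gamma>\<^sup>2 / 24"
    have \<delta>: "0 < \<delta>" "\<delta> \<le> 1" using \<gamma> power_le_one[of \<gamma> 2] by (auto simp: \<delta>_def)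
    obtain r where r: "\<And>j. majorant x r (\<lambda>y. u j y - u j x) (\<delta> * (1/2) ^ j)"
      using osc[OF \<delta>(1), of x] by blast
    have r0: "0 < r" using r[of 0] by (simp add: majorant_def)
    define m' where "m' n z = exp (a n * (4 * (\<rho> n)\<^sup>2 - (d n x z)\<^sup>2) + a n * (6 * \<delta>))" for n z
    have mw: "majorant x r (w n z) (m' n z)" for n z
    proof -
      have "majorant x r (\<lambda>y. - a n * ((d n y z)\<^sup>2 - (d n x z)\<^sup>2)) (\<bar>- a n\<bar> * (6 * \<delta>))"
        unfolding d_def by (rule majorant_cmult[OF majorant_cyl_dist[OF u r \<delta>]])
      moreover have "(\<lambda>y. - a n * ((d n y z)\<^sup>2 - (d n x z)\<^sup>2))
         = (\<lambda>y. a n * (4 * (\<rho> n)\<^sup>2 - (d n y z)\<^sup>2) - a n * (4 * (\<rho> n)\<^sup>2 - (d n x z)\<^sup>2))"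
        by (rule ext) (simp add: algebra_simps)
      ultimately have "majorant x r (\<lambda>y. a n * (4 * (\<rho> n)\<^sup>2 - (d n y z)\<^sup>2) - a n * (4 * (\<rho> n)\<^sup>2 - (d n x z)\<^sup>2))
         (a n * (6 * \<delta>))" using a(1)[of n] by simp
      from majorant_exp[OF this] show ?thesis unfolding w_def[abs_def] m'_def .
    qed
    define M where "M n = (\<Sum>z\<in>Z n. m' n z * (1 + norm (f z)))" for n
    have "majorant x r (g n) (M n)" for n
    proof -
      have "majorant x r (g n) (\<Sum>z\<in>Z n. m' n z)"
        unfolding g_def[abs_def] by (rule majorant_sum[OF Zfin r0 mw])
      moreover have "(\<Sum>z\<in>Z n. m' n z) \<le> M n"
        unfolding M_def m'_def by (intro sum_mono) simp
      ultimately show ?thesis by (rule majorant_le)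
    qed
    moreover have "majorant x r (G n) (M n)" for n
    proof -
      have "majorant x r (G n) (\<Sum>z\<in>Z n. m' n z * norm (f z))"
        unfolding G_def[abs_def] by (rule majorant_sum[OF Zfin r0 majorant_scaleR[OF mw majorant_const[OF r0]]])
      moreover have "(\<Sum>z\<in>Z n. m' n z * norm (f z)) \<le> M n"
        unfolding M_def m'_def by (intro sum_mono) simp
      ultimately show ?thesis by (rule majorant_le)
    qed
    moreover have "summable M"
    proof (rule summable_comparison_test_ev)
      show "summable (\<lambda>n. \<eta> * (1/2) ^ n)" by (intro summable_mult summable_geometric) simp
      obtain k :: nat where k: "2 / \<gamma>\<^sup>2 < real k" using reals_Archimedean2 by blast
      have "norm (M n) \<le> \<eta> * (1/2) ^ n" if n: "max k (m + 2) \<le> n" for n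
      proof -
        have "m' n z \<le> exp (- (a n * t n))" if "z \<in> Z n" for z
        proof -
          have "\<gamma> < d n x z" unfolding \<gamma>_def using far[OF m] ZA that n by auto
          then have dg: "\<gamma>\<^sup>2 \<le> (d n x z)\<^sup>2" using \<gamma> by (intro power_mono) auto
          have "\<rho> n \<le> \<rho> (m + 2)" unfolding \<rho>_def using n by (intro power_decreasing) auto
          then have "\<rho> n \<le> \<gamma> / 4" by (simp add: \<gamma>_def \<rho>_def)
          then have "(\<rho> n)\<^sup>2 \<le> (\<gamma> / 4)\<^sup>2" using \<rho>[of n] by (intro power_mono) auto
          then have rg: "4 * (\<rho> n)\<^sup>2 \<le> \<gamma>\<^sup>2 / 4" by (simp add: power_divide)
          have "2 / \<gamma>\<^sup>2 \<le> real (n + 1)" using k n by linarith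
          then have "1 / real (n + 1) \<le> \<gamma>\<^sup>2 / 2"
            using \<gamma> by (simp add: field_simps)
          then have "t n \<le> \<gamma>\<^sup>2 / 2" by (simp add: t_def min_le_iff_disj)
          then have "4 * (\<rho> n)\<^sup>2 - (d n x z)\<^sup>2 + 6 * \<delta> \<le> - t n"
            using dg rg by (simp add: \<delta>_def)
          then have "a n * (4 * (\<rho> n)\<^sup>2 - (d n x z)\<^sup>2 + 6 * \<delta>) \<le> a n * - t n"
            using a(1)[of n] by (intro mult_left_mono) auto
          then show ?thesis by (simp add: m'_def distrib_left)
        qed
        then have "M n \<le> (\<Sum>z\<in>Z n. exp (- (a n * t n)) * (1 + norm (f z)))"
          unfolding M_def by (intro sum_mono mult_right_mono) (auto simp: add_nonneg_nonneg)
        also have "\<dots> = exp (- (a n * t n)) * S n" by (simp only: S_def sum_distrib_left)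
        also have "\<dots> \<le> \<eta> * (1/2) ^ n" by (rule aS)
        finally have "M n \<le> \<eta> * (1/2) ^ n" .
        moreover have "0 \<le> M n" unfolding M_def m'_def
          by (intro sum_nonneg mult_nonneg_nonneg) (auto simp: add_nonneg_nonneg)
        ultimately show ?thesis by simp
      qed
      then show "\<forall>\<^sub>F n in sequentially. norm (M n) \<le> \<eta> * (1/2) ^ n"
        unfolding eventually_sequentially by blast
    qed
    ultimately show ?thesis by blast
  qed
  have sums: "summable (\<lambda>n. g n x)" "summable (\<lambda>n. G n x)" for x
  proof -
    obtain r M where *: "summable M" "\<And>n. majorant x r (g n) (M n)" "\<And>n. majorant x r (G n) (M n)"
      using local by blast
    have "0 \<le> r" using *(2) by (simp add: majorant_def less_imp_le)
    then have le: "norm (g n x) \<le> M n" "norm (G n x) \<le> M n" for n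
      using majorant_norm_le[OF *(2), of 0 n] majorant_norm_le[OF *(3), of 0 n] by auto
    show "summable (\<lambda>n. g n x)" "summable (\<lambda>n. G n x)"
      by (rule summable_comparison_test'[OF *(1), of 0], rule le)+
  qed
  define D where "D x = (\<Sum>n. g n x)" for x
  define N where "N x = (\<Sum>n. G n x)" for x
  define H where "H x = inverse (D x) *\<^sub>R N x" for x
  have g0: "0 \<le> g n x" for n x by (simp add: g_def w_def sum_nonneg)
  \<comment> \<open>The total weight also dominates \<open>norm (f x)\<close>, which pays for the unboundedness of \<open>f\<close>.\<close>
  have big: "1 \<le> D x" "1 + norm (f x) \<le> D x + e" for x
  proof -
    obtain n where n: "x \<in> A n"
    proof -
      define n where "n = (LEAST n. x \<in> W n)"
      have "x \<in> W n" unfolding n_def using cover LeastI_ex by metis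
      moreover have "x \<notin> W m" if "m < n" for m using not_less_Least that n_def by metis
      ultimately have "x \<in> A n" by (auto simp: A_def)
      then show thesis by (rule that)
    qed
    then obtain z where z: "z \<in> Z n" "d n x z \<le> \<rho> n" using net by blast
    have "x \<in> W n" using n by (simp add: A_def)
    moreover have "d n x x = 0" by (simp add: d_def)
    ultimately have fxz: "norm (f x - f z) \<le> e" using z \<rho>[of n] by (auto simp: W_def)
    have "(d n x z)\<^sup>2 \<le> (\<rho> n)\<^sup>2" using z by (intro power_mono) (auto simp: d_def)
    then have "t n \<le> 4 * (\<rho> n)\<^sup>2 - (d n x z)\<^sup>2" by (auto simp: t_def)
    then have "exp (a n * t n) \<le> w n z x"
      unfolding w_def using a(1)[of n] by simp
    moreover have "1 + S n \<le> exp (a n * t n)"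
    proof -
      have "\<eta> * (1/2) ^ n \<le> 1" using \<eta> by (intro mult_le_one) (auto simp: power_le_one)
      then have "exp (- (a n * t n)) * (1 + S n) \<le> 1" using a(2)[of n] by linarith
      then show ?thesis by (simp add: exp_minus field_simps)
    qed
    moreover have "1 + norm (f z) \<le> S n"
      unfolding S_def by (rule member_le_sum[OF z(1)]) (use Zfin in \<open>auto simp: add_nonneg_nonneg\<close>)
    moreover have "w n z x \<le> g n x"
      unfolding g_def by (rule member_le_sum[OF z(1)]) (use Zfin in \<open>auto simp: w_def\<close>)
    moreover have "g n x \<le> D x"
      unfolding D_def using sum_le_suminf[OF sums(1), of "{n}" x] g0 by simp
    ultimately have "2 + norm (f z) \<le> D x" by linarith
    then show "1 \<le> D x" "1 + norm (f x) \<le> D x + e"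
      using fxz norm_triangle_ineq2[of "f x" "f z"] norm_ge_zero[of "f z"] by linarith+
  qed
  have "norm (f x - H x) \<le> 2 * e" for x
  proof -
    have D: "1 \<le> D x" by (rule big)
    have nw: "norm (w n z x *\<^sub>R v) = w n z x * norm v" for n z and v :: 'b
      by (simp add: w_def)
    have wz: "norm (w n z x *\<^sub>R (f x - f z))
        \<le> e * w n z x + exp (- (a n * t n)) * (1 + norm (f z)) * (1 + norm (f x))"
      if z: "z \<in> Z n" for n z
    proof (cases "norm (f z - f x) \<le> e")
      case True
      then have "w n z x * norm (f x - f z) \<le> e * w n z x"
        by (simp add: w_def norm_minus_commute)
      moreover have "0 \<le> exp (- (a n * t n)) * (1 + norm (f z)) * (1 + norm (f x))"
        by (simp add: add_nonneg_nonneg)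
      ultimately show ?thesis unfolding nw by linarith
    next
      case False
      have "z \<in> W n" using ZA z by (auto simp: A_def)
      then have "3 * \<rho> n < d n z x"
        using False \<rho>[of n] unfolding W_def d_def by (smt (verit) cyl_dist_self mem_Collect_eq)
      then have 3: "(3 * \<rho> n)\<^sup>2 \<le> (d n x z)\<^sup>2"
        using \<rho>[of n] unfolding d_def cyl_dist_commute[of u n x] by (intro power_mono) auto
      have tn: "t n \<le> 3 * (\<rho> n)\<^sup>2" by (simp add: t_def)
      have "4 * (\<rho> n)\<^sup>2 - (d n x z)\<^sup>2 \<le> - t n"
      proof -
        have "(3 * \<rho> n)\<^sup>2 = 9 * (\<rho> n)\<^sup>2" by (simp add: power_mult_distrib)
        then show ?thesis
          using 3 tn zero_le_power2[of "\<rho> n"] by linarith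
      qed
      then have "a n * (4 * (\<rho> n)\<^sup>2 - (d n x z)\<^sup>2) \<le> a n * - t n"
        using a(1)[of n] by (intro mult_left_mono) auto
      then have "w n z x \<le> exp (- (a n * t n))" by (simp add: w_def)
      moreover have "norm (f x - f z) \<le> (1 + norm (f z)) * (1 + norm (f x))"
      proof -
        have "0 \<le> norm (f x) * norm (f z)" by simp
        moreover have "(1 + norm (f z)) * (1 + norm (f x))
            = 1 + norm (f x) + norm (f z) + norm (f x) * norm (f z)"
          by (simp add: algebra_simps)
        ultimately show ?thesis
          using norm_triangle_ineq4[of "f x" "f z"] by linarith
      qed
      ultimately have "w n z x * norm (f x - f z)
          \<le> exp (- (a n * t n)) * ((1 + norm (f z)) * (1 + norm (f x)))"
        by (intro mult_mono) auto
      moreover have "0 \<le> e * w n z x" using e by (simp add: w_def)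
      ultimately show ?thesis unfolding nw mult.assoc by linarith
    qed
    have gG: "norm (g n x *\<^sub>R f x - G n x) \<le> e * g n x + \<eta> * (1 + norm (f x)) * (1/2) ^ n" for n
    proof -
      have "g n x *\<^sub>R f x - G n x = (\<Sum>z\<in>Z n. w n z x *\<^sub>R (f x - f z))"
        by (simp add: g_def G_def scaleR_left.sum scaleR_right_diff_distrib sum_subtractf)
      also have "norm \<dots> \<le> (\<Sum>z\<in>Z n. e * w n z x + exp (- (a n * t n)) * (1 + norm (f z)) * (1 + norm (f x)))"
        by (rule sum_norm_le) (rule wz)
      also have "\<dots> = e * g n x + exp (- (a n * t n)) * S n * (1 + norm (f x))"
        unfolding g_def S_def sum_distrib_left sum_distrib_right by (rule sum.distrib)
      also have "exp (- (a n * t n)) * S n * (1 + norm (f x)) \<le> \<eta> * (1/2) ^ n * (1 + norm (f x))"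
        using aS by (intro mult_right_mono) (auto simp: add_nonneg_nonneg)
      finally show ?thesis by (simp add: mult_ac)
    qed
    have s1: "(\<lambda>n. e * g n x + \<eta> * (1 + norm (f x)) * (1/2) ^ n) sums (e * D x + \<eta> * (1 + norm (f x)) * 2)"
      unfolding D_def using geometric_sums[of "1/2 :: real"]
      by (intro sums_add sums_mult summable_sums[OF sums(1)]) simp
    have s2: "(\<lambda>n. g n x *\<^sub>R f x - G n x) sums (D x *\<^sub>R f x - N x)"
      unfolding D_def N_def by (intro sums_diff sums_scaleR_left summable_sums sums)
    have "norm (D x *\<^sub>R f x - N x) \<le> e * D x + \<eta> * (1 + norm (f x)) * 2"
    proof -
      have "norm (\<Sum>n. g n x *\<^sub>R f x - G n x)
          \<le> (\<Sum>n. e * g n x + \<eta> * (1 + norm (f x)) * (1/2) ^ n)"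
        by (rule norm_suminf_le[OF gG sums_summable[OF s1]])
      then show ?thesis by (simp only: sums_unique[OF s1] sums_unique[OF s2])
    qed
    also have "\<eta> * (1 + norm (f x)) * 2 \<le> e * D x"
    proof -
      have "1 + norm (f x) \<le> D x * (1 + e)"
      proof -
        have "1 * e \<le> D x * e" using D e by (intro mult_right_mono) auto
        then show ?thesis using big(2)[of x] by (simp add: distrib_left)
      qed
      then have "2 * \<eta> * (1 + norm (f x)) \<le> 2 * \<eta> * (D x * (1 + e))"
        using \<eta> by (intro mult_left_mono) auto
      also have "\<dots> = D x * (2 * \<eta> * (1 + e))" by (simp only: mult_ac)
      also have "\<dots> = D x * e" by (simp only: \<eta>(3))
      finally show ?thesis by (simp only: mult_ac)
    qed
    finally have le: "norm (D x *\<^sub>R f x - N x) \<le> 2 * e * D x" by simp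
    have "f x - H x = inverse (D x) *\<^sub>R (D x *\<^sub>R f x - N x)"
      using D by (simp add: H_def scaleR_right_diff_distrib)
    then have "norm (f x - H x) = norm (D x *\<^sub>R f x - N x) / D x"
      using D by (simp add: divide_inverse mult.commute)
    also have "\<dots> \<le> 2 * e"
      using D le by (simp add: pos_divide_le_eq)
    finally show ?thesis .
  qed
  moreover have "\<exists>r M. majorant x r H M" for x
  proof -
    obtain r M where *: "summable M" "\<And>n. majorant x r (g n) (M n)" "\<And>n. majorant x r (G n) (M n)"
      using local by blast
    have r: "0 < r" using *(2) by (simp add: majorant_def)
    have mD: "majorant x r D (suminf M)" by (rule majorant_suminf[OF *(2,1)]) (simp add: D_def)
    have mN: "majorant x r N (suminf M)" by (rule majorant_suminf[OF *(3,1)]) (simp add: N_def)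
    let ?K = "suminf M"
    have K: "0 \<le> ?K" by (rule majorant_nonneg[OF mD])
    define s where "s = r / (?K + 1)"
    have s: "0 < s" "s \<le> r" using r K by (auto simp: s_def field_simps)
    have "s / r * ?K < 1" using r K by (simp add: s_def)
    then have "s / r * ?K < D x" using big(1)[of x] by linarith
    from majorant_inverse[OF majorant_shrink[OF mD s] this]
    obtain L where "majorant x s (\<lambda>y. inverse (D y)) L" by blast
    from majorant_scaleR[OF this majorant_smaller[OF mN s]]
    show ?thesis unfolding H_def[abs_def] by blast
  qed
  ultimately show ?thesis by blast
qed

end

section \<open>Homogeneous components of a continuous polynomial\<close>

text \<open>
  Induction on the degree: \<open>g t - 2 ^ (Suc D) * g (t / 2)\<close> has no term of top degree, and its lower
  coefficients are those of \<open>g\<close> up to factors of absolute value at least one.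
\<close>
lemma coefficient_bound:
  "\<exists>K\<ge>0. \<forall>(c :: nat \<Rightarrow> real) C. (\<forall>t\<in>{0..1}. \<bar>\<Sum>m\<le>D. c m * t ^ m\<bar> \<le> C) \<longrightarrow> (\<forall>m\<le>D. \<bar>c m\<bar> \<le> K * C)"
proof (induction D)
  case 0
  show ?case by (rule exI[of _ 1]) (auto dest: bspec[of _ _ 0])
next
  case (Suc D)
  then obtain K where K: "0 \<le> K" and IH: "\<And>(c :: nat \<Rightarrow> real) C m.
      (\<forall>t\<in>{0..1}. \<bar>\<Sum>m\<le>D. c m * t ^ m\<bar> \<le> C) \<Longrightarrow> m \<le> D \<Longrightarrow> \<bar>c m\<bar> \<le> K * C"
    by blast
  let ?L = "K * (1 + 2 ^ Suc D)"
  have L: "0 \<le> ?L" using K by simp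
  show ?case
  proof (rule exI[of _ "1 + real (D + 2) * ?L"], intro conjI allI impI)
    show "0 \<le> 1 + real (D + 2) * ?L" using L by simp
    fix c :: "nat \<Rightarrow> real" and C m
    assume c: "\<forall>t\<in>{0..1}. \<bar>\<Sum>m\<le>Suc D. c m * t ^ m\<bar> \<le> C" and m: "m \<le> Suc D"
    let ?g = "\<lambda>t. \<Sum>m\<le>Suc D. c m * t ^ m"
    have C: "0 \<le> C" using c[rule_format, of 0] by (simp del: sum.atMost_Suc)
    let ?c = "\<lambda>m. c m * (1 - 2 ^ (Suc D - m))"
    have "\<bar>\<Sum>m\<le>D. ?c m * t ^ m\<bar> \<le> (1 + 2 ^ Suc D) * C" if t: "t \<in> {0..1}" for t
    proof -
      have "?g t - 2 ^ Suc D * ?g (t / 2) = (\<Sum>m\<le>Suc D. ?c m * t ^ m)"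
        unfolding sum_distrib_left sum_subtractf[symmetric]
      proof (rule sum.cong[OF refl])
        fix m assume "m \<in> {..Suc D}"
        then have "(2 :: real) ^ Suc D = 2 ^ (Suc D - m) * 2 ^ m"
          by (simp flip: power_add del: power_Suc)
        then show "c m * t ^ m - 2 ^ Suc D * (c m * (t / 2) ^ m) = ?c m * t ^ m"
          by (simp add: power_divide algebra_simps del: power_Suc)
      qed
      also have "\<dots> = (\<Sum>m\<le>D. ?c m * t ^ m)" by simp
      finally have eq: "(\<Sum>m\<le>D. ?c m * t ^ m) = ?g t - 2 ^ Suc D * ?g (t / 2)" ..
      have "\<bar>?g t\<bar> \<le> C" using c t by blast
      moreover have "\<bar>?g (t / 2)\<bar> \<le> C" by (rule c[rule_format]) (use t in simp)
      then have "2 ^ Suc D * \<bar>?g (t / 2)\<bar> \<le> 2 ^ Suc D * C" by (rule mult_left_mono) simp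
      moreover have "\<bar>?g t - 2 ^ Suc D * ?g (t / 2)\<bar> \<le> \<bar>?g t\<bar> + 2 ^ Suc D * \<bar>?g (t / 2)\<bar>"
        using abs_triangle_ineq4[of "?g t" "2 ^ Suc D * ?g (t / 2)"] by (simp add: abs_mult)
      ultimately show ?thesis unfolding eq distrib_right by linarith
    qed
    then have low: "\<bar>c m\<bar> \<le> ?L * C" if "m \<le> D" for m
    proof -
      have "\<bar>?c m\<bar> \<le> K * ((1 + 2 ^ Suc D) * C)"
        by (rule IH) (use \<open>\<And>t. t \<in> {0..1} \<Longrightarrow> _\<close> that in auto)
      moreover have "(2 :: real) ^ 1 \<le> 2 ^ (Suc D - m)"
        using that by (intro power_increasing) auto
      then have "\<bar>c m\<bar> * 1 \<le> \<bar>c m\<bar> * \<bar>1 - 2 ^ (Suc D - m)\<bar>"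
        by (intro mult_left_mono) auto
      ultimately show ?thesis by (simp add: abs_mult mult.assoc)
    qed
    have LC: "0 \<le> ?L * C" using L C by (rule mult_nonneg_nonneg)
    show "\<bar>c m\<bar> \<le> (1 + real (D + 2) * ?L) * C"
    proof (cases "m \<le> D")
      case True
      have "?L * C \<le> real (D + 2) * (?L * C)"
        using mult_right_mono[OF _ LC, of 1 "real (D + 2)"] by simp
      then show ?thesis using low[OF True] C unfolding distrib_right mult_1 mult.assoc by linarith
    next
      case False
      then have "m = Suc D" using m by simp
      have "?g 1 = (\<Sum>m\<le>D. c m) + c (Suc D)" by simp
      moreover have "\<bar>?g 1\<bar> \<le> C" by (rule c[rule_format]) simp
      moreover have "\<bar>\<Sum>m\<le>D. c m\<bar> \<le> (\<Sum>m\<le>D. ?L * C)"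
        using low by (intro order_trans[OF sum_abs] sum_mono) auto
      then have "\<bar>\<Sum>m\<le>D. c m\<bar> \<le> real (D + 1) * (?L * C)" by simp
      moreover have "real (D + 1) * (?L * C) \<le> real (D + 2) * (?L * C)"
        using LC by (intro mult_right_mono) auto
      ultimately show ?thesis
        unfolding \<open>m = Suc D\<close> distrib_right mult_1 mult.assoc by linarith
    qed
  qed
qed

lemma n_linear_replicate_scaleR:
  "n_linear n B \<Longrightarrow> B (replicate n (t *\<^sub>R z)) = t ^ n *\<^sub>R B (replicate n z)"
proof (induction n arbitrary: B)
  case (Suc n)
  have B: "n_linear n (\<lambda>l. B (a # l))" "length l = n \<Longrightarrow> linear (\<lambda>a. B (a # l))" for a l
    using Suc.prems by (auto simp: n_linear_Suc)
  show ?case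
    using Suc.IH[OF B(1)] linear_scale[OF B(2), of "replicate n z"] by simp
qed simp

context norm_fun
begin

lemma p_sum_le: "p (\<Sum>i\<in>A. v i) \<le> (\<Sum>i\<in>A. p (v i))"
proof (induction A rule: infinite_finite_induct)
  case (insert i A)
  then show ?case using p_triangle[of "v i" "\<Sum>i\<in>A. v i"] by simp
qed simp_all

lemma bounded_form_unit_ball:
  assumes "0 \<le> C"
  shows "n_linear n B \<Longrightarrow> (\<And>ys. length ys = n \<Longrightarrow> \<forall>y\<in>set ys. p y \<le> 1 \<Longrightarrow> norm (B ys) \<le> C) \<Longrightarrow>
    bounded_form n B C"
proof (induction n arbitrary: B)
  case 0
  then show ?case using assms by (auto simp: bounded_form_def)
next
  case (Suc n)
  have B: "n_linear n (\<lambda>l. B (a # l))" "length l = n \<Longrightarrow> linear (\<lambda>a. B (a # l))" for a l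
    using Suc.prems(1) by (auto simp: n_linear_Suc)
  have 1: "bounded_form n (\<lambda>l. B (a # l)) C" if "p a \<le> 1" for a
    by (rule Suc.IH[OF B(1)], rule Suc.prems(2)) (use that in auto)
  show ?case
    unfolding bounded_form_def
  proof (intro conjI allI impI)
    fix xs :: "'a list" assume "length xs = Suc n"
    then obtain a l where xs: "xs = a # l" and l: "length l = n" by (cases xs) auto
    show "norm (B xs) \<le> C * prod_list (map p xs)"
    proof (cases "a = 0")
      case True
      then show ?thesis using linear_0[OF B(2)[OF l]] by (simp add: xs)
    next
      case False
      then have a: "0 < p a" using p_nonneg[of a] p_eq_0[of a] by linarith
      let ?a = "inverse (p a) *\<^sub>R a"
      have "p ?a \<le> 1" using a by (simp add: p_scale del: p_eq_0)
      from 1[OF this] have "norm (B (?a # l)) \<le> C * prod_list (map p l)"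
        using l by (simp add: bounded_form_def)
      moreover have "B (?a # l) = inverse (p a) *\<^sub>R B xs"
        using linear_scale[OF B(2)[OF l]] by (simp add: xs)
      ultimately show ?thesis using a by (simp add: xs field_simps)
    qed
  qed (use Suc.prems assms in auto)
qed

lemma bounded_form_polar:
  fixes B :: "'a list \<Rightarrow> 'b::real_normed_vector"
  assumes B: "n_linear n B" and C: "0 \<le> C" "\<And>z. norm (B (replicate n z)) \<le> C * p z ^ n"
  shows "bounded_form n (polar n (\<lambda>z. B (replicate n z))) (2 ^ n * (C * real n ^ n))"
proof (rule bounded_form_unit_ball[OF _ n_linear_polar[OF B]])
  show "0 \<le> 2 ^ n * (C * real n ^ n)" using C by simp
  fix ys :: "'a list" assume ys: "length ys = n" "\<forall>y\<in>set ys. p y \<le> 1"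
  have le: "norm ((-1) ^ (n + card A) *\<^sub>R B (replicate n (\<Sum>i\<in>A. ys ! i))) \<le> C * real n ^ n"
    if A: "A \<in> Pow {..<n}" for A
  proof -
    have "p (\<Sum>i\<in>A. ys ! i) \<le> (\<Sum>i\<in>A. p (ys ! i))" by (rule p_sum_le)
    also have "\<dots> \<le> (\<Sum>i\<in>A. 1)" using A ys by (intro sum_mono) auto
    also have "\<dots> \<le> real n" using card_mono[of "{..<n}" A] A by simp
    finally have "C * p (\<Sum>i\<in>A. ys ! i) ^ n \<le> C * real n ^ n"
      using C by (intro mult_left_mono power_mono) auto
    moreover have "norm ((-1 :: real) ^ (n + card A)) = 1" by (simp only: norm_power) simp
    ultimately show ?thesis using C(2)[of "\<Sum>i\<in>A. ys ! i"] by (simp only: norm_scaleR real_norm_def)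
  qed
  let ?s = "\<Sum>A\<in>Pow {..<n}. (-1) ^ (n + card A) *\<^sub>R B (replicate n (\<Sum>i\<in>A. ys ! i))"
  have "norm ?s \<le> (\<Sum>A\<in>Pow {..<n}. C * real n ^ n)"
    by (rule sum_norm_le) (rule le)
  also have "\<dots> = 2 ^ n * (C * real n ^ n)" by (simp add: card_Pow)
  finally have s: "norm ?s \<le> 2 ^ n * (C * real n ^ n)" .
  have "norm (polar n (\<lambda>z. B (replicate n z)) ys) = norm ?s / fact n"
    by (simp add: polar_def)
  also have "\<dots> \<le> norm ?s"
    using mult_left_mono[of 1 "fact n" "norm ?s"] by (simp add: divide_le_eq)
  finally show "norm (polar n (\<lambda>z. B (replicate n z)) ys) \<le> 2 ^ n * (C * real n ^ n)"
    using s by linarith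
qed

text \<open>
  A polynomial is given by arbitrary multilinear forms. If it is bounded near the origin, then so
  are its homogeneous components, by \<open>coefficient_bound\<close> along rays, and hence their polar forms.
\<close>
lemma polynomial_bounded_forms:
  fixes P :: "'a \<Rightarrow> real"
  assumes P: "polynomial_map P" and \<delta>: "0 < \<delta>" and bd: "\<And>z. p z < \<delta> \<Longrightarrow> \<bar>P z\<bar> \<le> 1"
  shows "\<exists>D B c. (\<forall>m. bounded_form m (B m) (c m)) \<and> (\<forall>z. P z = (\<Sum>m\<le>D. B m (replicate m z)))"
proof -
  obtain N :: nat and d F where F: "\<forall>i<N. homogeneous_polynomial (d i) (F i)"
    and PF: "\<And>x. P x = (\<Sum>i<N. F i x)"
    using P unfolding polynomial_map_def by blast
  have "\<forall>i. \<exists>b. i < N \<longrightarrow> n_linear (d i) b \<and> (\<forall>x. F i x = b (replicate (d i) x))"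
    using F unfolding homogeneous_polynomial_def by blast
  from choice[OF this] obtain b where
    b: "\<And>i. i < N \<Longrightarrow> n_linear (d i) (b i)" "\<And>i x. i < N \<Longrightarrow> F i x = b i (replicate (d i) x)"
    by blast
  define D where "D = (\<Sum>i<N. d i)"
  have dD: "d i \<le> D" if "i < N" for i
    unfolding D_def using that by (intro member_le_sum) auto
  define A where "A m l = (\<Sum>i\<in>{i\<in>{..<N}. d i = m}. b i l)" for m l
  have A: "n_linear m (A m)" for m
    unfolding A_def[abs_def] using b(1) by (intro n_linear_sum) auto
  have PA: "P z = (\<Sum>m\<le>D. A m (replicate m z))" for z
  proof -
    have "P z = (\<Sum>i<N. b i (replicate (d i) z))" unfolding PF using b(2) by (intro sum.cong) auto
    also have "\<dots> = (\<Sum>m\<le>D. \<Sum>i\<in>{i\<in>{..<N}. d i = m}. b i (replicate (d i) z))"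
      by (rule sum.group[symmetric]) (use dD in auto)
    also have "\<dots> = (\<Sum>m\<le>D. A m (replicate m z))"
      unfolding A_def by (intro sum.cong) auto
    finally show ?thesis .
  qed
  obtain K where K: "0 \<le> K" "\<And>(c :: nat \<Rightarrow> real) C m.
      (\<forall>t\<in>{0..1}. \<bar>\<Sum>m\<le>D. c m * t ^ m\<bar> \<le> C) \<Longrightarrow> m \<le> D \<Longrightarrow> \<bar>c m\<bar> \<le> K * C"
    using coefficient_bound[of D] by blast
  have small: "\<bar>A m (replicate m z)\<bar> \<le> K" if z: "p z \<le> \<delta> / 2" and m: "m \<le> D" for m z
  proof -
    have "\<bar>\<Sum>m\<le>D. A m (replicate m z) * t ^ m\<bar> \<le> 1" if t: "t \<in> {0..1}" for t
    proof -
      have "(\<Sum>m\<le>D. A m (replicate m z) * t ^ m) = P (t *\<^sub>R z)"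
        unfolding PA n_linear_replicate_scaleR[OF A] by (simp add: mult.commute)
      moreover have "p (t *\<^sub>R z) \<le> 1 * p z"
        unfolding p_scale using t by (intro mult_right_mono) auto
      ultimately show ?thesis using bd[of "t *\<^sub>R z"] z \<delta> by simp
    qed
    then show ?thesis using K(2)[of "\<lambda>m. A m (replicate m z)" 1 m] m by simp
  qed
  have A_le: "\<bar>A m (replicate m z)\<bar> \<le> K * (2 / \<delta>) ^ m * p z ^ m" if m: "m \<le> D" for m z
  proof (cases "z = 0")
    case True
    show ?thesis
    proof (cases m)
      case 0
      then show ?thesis using small[of 0 m] m \<delta> by simp
    next
      case (Suc k)
      have "A m (replicate m (0 *\<^sub>R z)) = 0"
        unfolding n_linear_replicate_scaleR[OF A] using Suc by simp
      then show ?thesis using True K(1) Suc by simp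
    qed
  next
    case False
    then have z: "0 < p z" using p_nonneg[of z] p_eq_0[of z] by linarith
    let ?t = "2 / \<delta> * p z"
    let ?w = "inverse ?t *\<^sub>R z"
    have t: "0 < ?t" using z \<delta> by simp
    have "p ?w = \<delta> / 2" unfolding p_scale using z \<delta> False by (simp add: field_simps)
    then have "\<bar>A m (replicate m ?w)\<bar> \<le> K" by (intro small[OF _ m]) simp
    moreover have "?t *\<^sub>R ?w = z"
      by (simp only: scaleR_scaleR right_inverse[OF less_imp_neq[OF t, symmetric]] scaleR_one)
    then have "A m (replicate m z) = ?t ^ m * A m (replicate m ?w)"
      using n_linear_replicate_scaleR[OF A, of m ?t ?w] by (simp only: real_scaleR_def)
    moreover have "0 < ?t ^ m" using t by simp
    ultimately have "\<bar>A m (replicate m z)\<bar> \<le> ?t ^ m * K"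
      by (simp add: abs_mult)
    also have "?t ^ m * K = K * (2 / \<delta>) ^ m * p z ^ m"
      by (simp only: power_mult_distrib mult_ac)
    finally show ?thesis .
  qed
  let ?C = "\<lambda>m. K * (2 / \<delta>) ^ m"
  define B where "B m = (if m \<le> D then polar m (\<lambda>z. A m (replicate m z)) else (\<lambda>_. 0))" for m
  define c where "c m = (if m \<le> D then 2 ^ m * (?C m * real m ^ m) else 0)" for m
  have "bounded_form m (B m) (c m)" for m
  proof (cases "m \<le> D")
    case True
    have "bounded_form m (polar m (\<lambda>z. A m (replicate m z))) (2 ^ m * (?C m * real m ^ m))"
      by (rule bounded_form_polar[OF A]) (use K \<delta> A_le[OF True] in auto)
    then show ?thesis using True by (simp add: B_def c_def)
  next
    case False
    then show ?thesis by (simp add: B_def c_def)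
  qed
  moreover have "P z = (\<Sum>m\<le>D. B m (replicate m z))" for z
    unfolding PA by (intro sum.cong) (auto simp: B_def polar_diag[OF A])
  ultimately show ?thesis by blast
qed

end

section \<open>Coordinates from a separating polynomial\<close>

context norm_fun
begin

lemma separating_forms:
  fixes P :: "'a \<Rightarrow> real"
  assumes P: "separating_polynomial p P"
  shows "\<exists>D B c. (\<forall>m. bounded_form m (B m) (c m)) \<and>
    (\<forall>z. P z = (\<Sum>m\<le>D. B m (replicate m z)))"
proof -
  interpret N: Metric_space UNIV "norm_dist p"
    by (rule Metric_space_norm_dist[OF norm_on_space])
  have P0: "P 0 = 0" and cont: "continuous_map N.mtopology euclideanreal P"
    using P by (auto simp: separating_polynomial_def norm_topology_def)
  have "openin N.mtopology {z \<in> topspace N.mtopology. P z \<in> {-1<..<1}}"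
    by (rule openin_continuous_map_preimage[OF cont]) (simp add: open_openin[symmetric])
  then have "openin N.mtopology {z. P z \<in> {-1<..<1}}" by simp
  moreover have zero: "0 \<in> {z. P z \<in> {-1<..<1}}" using P0 by simp
  ultimately obtain \<delta> where \<delta>: "0 < \<delta>" "N.mball 0 \<delta> \<subseteq> {z. P z \<in> {-1<..<1}}"
    unfolding N.openin_mtopology by blast
  have "\<bar>P z\<bar> \<le> 1" if "p z < \<delta>" for z
  proof -
    have "z \<in> N.mball 0 \<delta>" using that by (simp add: norm_dist_def)
    then have "P z \<in> {-1<..<1}" using \<delta>(2) by blast
    then show ?thesis by (simp add: abs_le_iff)
  qed
  then show ?thesis
    using polynomial_bounded_forms \<delta>(1) P unfolding separating_polynomial_def by blast
qed

text \<open>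
  A homogeneous polynomial grows like a power of the distance along a ray from the origin, so a lower
  bound on the unit sphere yields one outside every ball. The third claim factorizes the growth in \<open>x\<close> and \<open>a\<close>, so that
  a scaling chosen for \<open>a\<close> alone controls all \<open>x\<close>.
\<close>
lemma separating_square_sum:
  fixes B :: "nat \<Rightarrow> 'a list \<Rightarrow> real"
  assumes B: "\<And>m. bounded_form m (B m) (c m)"
    and P0: "(\<Sum>m\<le>D. B m (replicate m 0)) = 0"
    and P1: "\<forall>z. p z = 1 \<longrightarrow> 1 \<le> \<bar>\<Sum>m\<le>D. B m (replicate m z)\<bar>"
    and Q_def: "Q = (\<lambda>z. \<Sum>m\<le>D. (B m (replicate m z))\<^sup>2)" and K_def: "K = (\<Sum>m\<le>D. (c m)\<^sup>2)"
  shows "0 < s \<Longrightarrow> \<exists>\<eta>>0. \<forall>z. s \<le> p z \<longrightarrow> \<eta> \<le> Q z"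
    and "p z \<le> 1 \<Longrightarrow> Q z \<le> K * p z"
    and "majorant x 1 (\<lambda>y. Q (y - a)) (K * ((1 + p x) * (1 + p a)) ^ (2 * D))"
proof -
  have c: "0 \<le> c m" for m using B by (simp add: bounded_form_def)
  have lin: "n_linear m (B m)" for m using B by (simp add: bounded_form_def)
  have zero: "B m (replicate m 0) = 0" if "m \<noteq> 0" for m
    using bounded_form_diag[OF B, of m 0] that by (simp add: power_0_left)
  have B0: "B 0 [] = 0"
  proof -
    have "(\<Sum>m\<le>D. B m (replicate m 0)) = (\<Sum>m\<in>{0}. B m (replicate m 0))"
      by (rule sum.mono_neutral_right) (use zero in auto)
    then show ?thesis using P0 by simp
  qed
  show "\<exists>\<eta>>0. \<forall>z. s \<le> p z \<longrightarrow> \<eta> \<le> Q z" if s: "0 < s"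
  proof (intro exI conjI allI impI)
    let ?s = "min 1 s"
    let ?\<eta> = "(?s ^ D / real (D + 1))\<^sup>2"
    show "0 < ?\<eta>" using s by simp
    fix z assume z: "s \<le> p z"
    then have z0: "0 < p z" "z \<noteq> 0" using s by auto
    let ?w = "inverse (p z) *\<^sub>R z"
    have "p ?w = 1" unfolding p_scale using z0 by simp
    then have "1 \<le> \<bar>\<Sum>m\<le>D. B m (replicate m ?w)\<bar>" using P1 by blast
    then have "1 \<le> (\<Sum>m\<le>D. \<bar>B m (replicate m ?w)\<bar>)"
      by (rule order_trans[OF _ sum_abs])
    have "\<exists>m\<le>D. 1 / real (D + 1) \<le> \<bar>B m (replicate m ?w)\<bar>"
    proof (rule ccontr)
      assume "\<not> ?thesis"
      then have "(\<Sum>m\<le>D. \<bar>B m (replicate m ?w)\<bar>) < (\<Sum>m\<le>D. 1 / real (D + 1))"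
        by (intro sum_strict_mono) auto
      then show False using \<open>1 \<le> (\<Sum>m\<le>D. \<bar>B m (replicate m ?w)\<bar>)\<close> by simp
    qed
    then obtain m where m: "m \<le> D" "1 / real (D + 1) \<le> \<bar>B m (replicate m ?w)\<bar>" by blast
    have "?s ^ D \<le> ?s ^ m" using m s by (intro power_decreasing) auto
    also have "\<dots> \<le> p z ^ m" using z s by (intro power_mono) auto
    finally have "?s ^ D * (1 / real (D + 1)) \<le> p z ^ m * \<bar>B m (replicate m ?w)\<bar>"
      using m s by (intro mult_mono) auto
    also have "\<dots> = \<bar>B m (replicate m z)\<bar>"
      using n_linear_replicate_scaleR[OF lin, of m "p z" ?w] z0 by (simp add: abs_mult)
    finally have "?\<eta> \<le> \<bar>B m (replicate m z)\<bar>\<^sup>2"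
      using s by (intro power_mono) auto
    also have "\<dots> \<le> Q z"
      unfolding Q_def power2_abs using m by (intro member_le_sum) auto
    finally show "?\<eta> \<le> Q z" .
  qed
  show "Q z \<le> K * p z" if z: "p z \<le> 1"
    unfolding Q_def K_def sum_distrib_right
  proof (rule sum_mono)
    fix m
    show "(B m (replicate m z))\<^sup>2 \<le> (c m)\<^sup>2 * p z"
    proof (cases m)
      case 0
      then show ?thesis using B0 by simp
    next
      case (Suc k)
      have "\<bar>B m (replicate m z)\<bar>\<^sup>2 \<le> (c m * p z ^ m)\<^sup>2"
        using bounded_form_diag[OF B, of m z] by (intro power_mono) auto
      also have "\<dots> = (c m)\<^sup>2 * p z ^ (2 * m)"
        by (simp add: power_mult_distrib power_mult[symmetric] mult.commute)
      also have "\<dots> \<le> (c m)\<^sup>2 * p z ^ 1"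
        using z Suc by (intro mult_left_mono power_decreasing) auto
      finally show ?thesis by simp
    qed
  qed
  show "majorant x 1 (\<lambda>y. Q (y - a)) (K * ((1 + p x) * (1 + p a)) ^ (2 * D))"
  proof (rule majorant_le)
    show "majorant x 1 (\<lambda>y. Q (y - a)) (\<Sum>m\<le>D. (c m * (p (x - a) + 1) ^ m)\<^sup>2)"
      unfolding Q_def by (intro majorant_sum majorant_power majorant_translated_form B) auto
    let ?R = "(1 + p x) * (1 + p a)"
    have "p (x - a) + 1 \<le> ?R"
    proof -
      have "0 \<le> p x * p a" by simp
      moreover have "?R = 1 + p x + p a + p x * p a" by (simp add: algebra_simps)
      ultimately show ?thesis using p_triangle_diff[of x a] by linarith
    qed
    then have R: "p (x - a) + 1 \<le> ?R" "1 \<le> ?R"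
      using p_nonneg[of "x - a"] by linarith+
    show "(\<Sum>m\<le>D. (c m * (p (x - a) + 1) ^ m)\<^sup>2) \<le> K * ?R ^ (2 * D)"
      unfolding K_def sum_distrib_right
    proof (rule sum_mono)
      fix m assume "m \<in> {..D}"
      have "(p (x - a) + 1) ^ (2 * m) \<le> ?R ^ (2 * m)" using R by (intro power_mono) auto
      also have "\<dots> \<le> ?R ^ (2 * D)" using R \<open>m \<in> {..D}\<close> by (intro power_increasing) auto
      finally have "(c m)\<^sup>2 * (p (x - a) + 1) ^ (2 * m) \<le> (c m)\<^sup>2 * ?R ^ (2 * D)"
        by (rule mult_left_mono) simp
      then show "(c m * (p (x - a) + 1) ^ m)\<^sup>2 \<le> (c m)\<^sup>2 * ?R ^ (2 * D)"
        by (simp add: power_mult_distrib power_mult[symmetric] mult.commute)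
    qed
  qed
qed

lemma separating_coordinates:
  fixes P :: "'a \<Rightarrow> real" and a :: "nat \<Rightarrow> 'a"
  assumes P: "separating_polynomial p P"
    and dense: "\<And>x s. 0 < s \<Longrightarrow> \<exists>j. p (x - a j) < s"
  shows "\<exists>u :: nat \<Rightarrow> 'a \<Rightarrow> real. (\<forall>j x. 0 \<le> u j x \<and> u j x \<le> 1) \<and>
    (\<forall>x \<delta>. 0 < \<delta> \<longrightarrow> (\<exists>r. \<forall>j. majorant x r (\<lambda>y. u j y - u j x) (\<delta> * (1/2) ^ j))) \<and>
    (\<forall>x s. 0 < s \<longrightarrow> (\<exists>j \<gamma>. 0 < \<gamma> \<and> (\<forall>z. \<bar>u j z - u j x\<bar> < \<gamma> \<longrightarrow> p (z - x) < s)))"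
proof -
  obtain D B c where B: "\<And>m. bounded_form m (B m) (c m)"
    and PB: "\<And>z. P z = (\<Sum>m\<le>D. B m (replicate m z))"
    using separating_forms[OF P] by blast
  have P0: "(\<Sum>m\<le>D. B m (replicate m 0)) = 0"
    and P1: "\<forall>z. p z = 1 \<longrightarrow> 1 \<le> \<bar>\<Sum>m\<le>D. B m (replicate m z)\<bar>"
    using P unfolding separating_polynomial_def PB by auto
  define Q where "Q = (\<lambda>z. \<Sum>m\<le>D. (B m (replicate m z))\<^sup>2)"
  define K where "K = (\<Sum>m\<le>D. (c m)\<^sup>2)"
  have K: "0 \<le> K" by (simp add: K_def sum_nonneg)
  have Q0: "0 \<le> Q z" for z by (simp add: Q_def sum_nonneg)
  note Q = separating_square_sum[OF B P0 P1 Q_def K_def]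
  \<comment> \<open>This scaling cancels the growth of \<open>Q (x - a j)\<close> in \<open>a j\<close> and makes the oscillations summable.\<close>
  define \<mu> where "\<mu> j = (1/2) ^ j / (1 + p (a j)) ^ (2 * D)" for j
  have pa: "0 < 1 + p x" for x using p_nonneg[of x] by linarith
  have \<mu>: "0 < \<mu> j" for j using pa[of "a j"] by (simp add: \<mu>_def)
  define u where "u j y = exp (- (\<mu> j * Q (y - a j)))" for j y
  show ?thesis
  proof (intro exI[of _ u] conjI allI impI)
    show "0 \<le> u j x" for j x by (simp add: u_def)
    show "u j x \<le> 1" for j x using \<mu>[of j] Q0 by (simp add: u_def)
  next
    fix x and \<delta> :: real assume \<delta>: "0 < \<delta>"
    define T where "T = K * (1 + p x) ^ (2 * D)"
    have T: "0 \<le> T" using K pa[of x] by (simp add: T_def)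
    define r where "r = min 1 (min 1 \<delta> / (2 * (T + 1)))"
    have r: "0 < r" "r \<le> 1" using \<delta> T by (auto simp: r_def)
    have "r * (T + 1) \<le> min 1 \<delta> / (2 * (T + 1)) * (T + 1)"
      using T by (intro mult_right_mono) (auto simp: r_def)
    also have "\<dots> = min 1 \<delta> / 2" using T by (simp add: field_simps)
    finally have rT: "r * T \<le> 1" "2 * (r * T) \<le> \<delta>"
      using r by (auto simp: distrib_left)
    show "\<exists>r. \<forall>j. majorant x r (\<lambda>y. u j y - u j x) (\<delta> * (1/2) ^ j)"
    proof (intro exI[of _ r] allI)
      fix j
      let ?q = "(1/2 :: real) ^ j"
      let ?F = "\<lambda>y. - (\<mu> j * Q (y - a j))"
      let ?d = "r * T * ?q"
      have q: "0 \<le> ?q" "?q \<le> 1" by (auto simp: power_le_one)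
      have "majorant x 1 (\<lambda>y. - \<mu> j * Q (y - a j)) (\<bar>- \<mu> j\<bar> * (K * ((1 + p x) * (1 + p (a j))) ^ (2 * D)))"
        by (rule majorant_cmult[OF Q(3)])
      moreover have "\<bar>- \<mu> j\<bar> * (K * ((1 + p x) * (1 + p (a j))) ^ (2 * D)) = T * ?q"
        using \<mu>[of j] pa[of "a j"] by (simp add: \<mu>_def T_def power_mult_distrib)
      ultimately have "majorant x 1 ?F (T * ?q)" by simp
      from majorant_shrink[OF this r] have "majorant x r (\<lambda>y. ?F y - ?F x) ?d" by (simp add: mult.assoc)
      from majorant_exp_diff[OF this]
      have "majorant x r (\<lambda>y. u j y - u j x) (exp (?F x) * (exp ?d - 1))" unfolding u_def .
      moreover have "exp (?F x) * (exp ?d - 1) \<le> \<delta> * ?q"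
      proof -
        have d0: "0 \<le> ?d" using r T q by simp
        have d1: "?d \<le> 1" using rT q r T mult_mono[of "r * T" 1 ?q 1] by simp
        have "exp ?d \<le> 1 + ?d + ?d\<^sup>2" by (rule exp_bound[OF d0 d1])
        moreover have "?d\<^sup>2 \<le> ?d" using d0 d1 by (simp add: power2_eq_square mult_left_le)
        ultimately have "exp ?d - 1 \<le> 2 * (r * T) * ?q" by simp
        also have "\<dots> \<le> \<delta> * ?q" using rT q by (intro mult_right_mono) auto
        finally have "exp ?d - 1 \<le> \<delta> * ?q" .
        moreover have "exp (?F x) \<le> 1" using \<mu>[of j] Q0 by simp
        moreover have "0 \<le> exp ?d - 1" using d0 by simp
        ultimately have "exp (?F x) * (exp ?d - 1) \<le> 1 * (\<delta> * ?q)"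
          by (intro mult_mono) auto
        then show ?thesis by simp
      qed
      ultimately show "majorant x r (\<lambda>y. u j y - u j x) (\<delta> * ?q)" by (rule majorant_le)
    qed
  next
    fix x and s :: real assume s: "0 < s"
    obtain \<eta> where \<eta>: "0 < \<eta>" "\<And>z. s / 2 \<le> p z \<Longrightarrow> \<eta> \<le> Q z"
      using Q(1)[of "s / 2"] s by auto
    define t where "t = min (min 1 (s / 2)) (\<eta> / (2 * (K + 1)))"
    have t: "0 < t" using s \<eta> K by (simp add: t_def)
    obtain j where j: "p (x - a j) < t" using dense[OF t] by blast
    have jt: "p (x - a j) \<le> 1" "p (x - a j) < s / 2" "p (x - a j) \<le> \<eta> / (2 * (K + 1))"
      using j by (auto simp: t_def)
    have "Q (x - a j) \<le> K * p (x - a j)" by (rule Q(2)[OF jt(1)])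
    also have "\<dots> \<le> (K + 1) * (\<eta> / (2 * (K + 1)))"
      using jt(3) K by (intro mult_mono) auto
    also have "\<dots> = \<eta> / 2"
    proof -
      have "L * (\<eta> / (2 * L)) = \<eta> / 2" if "L \<noteq> 0" for L using that by simp
      then show ?thesis using K by (smt (verit))
    qed
    finally have Qx: "\<mu> j * Q (x - a j) \<le> \<mu> j * (\<eta> / 2)"
      using \<mu>[of j] by (intro mult_left_mono) auto
    \<comment> \<open>The gap between the values of \<open>u j\<close> that correspond to \<open>Q = \<eta> / 2\<close> and \<open>Q = \<eta>\<close>.\<close>
    define \<gamma> where "\<gamma> = exp (- (\<mu> j * (\<eta> / 2))) - exp (- (\<mu> j * \<eta>))"
    have \<gamma>: "0 < \<gamma>" using \<mu>[of j] \<eta> by (simp add: \<gamma>_def)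
    have "p (z - x) < s" if z: "\<bar>u j z - u j x\<bar> < \<gamma>" for z
    proof -
      have "exp (- (\<mu> j * (\<eta> / 2))) \<le> u j x" using Qx by (simp add: u_def)
      then have "exp (- (\<mu> j * \<eta>)) < u j z" using z by (simp add: \<gamma>_def abs_less_iff)
      then have "Q (z - a j) < \<eta>" using \<mu>[of j] by (simp add: u_def)
      then have "p (z - a j) < s / 2" using \<eta>(2)[of "z - a j"] by linarith
      then show ?thesis
        using jt(2) p_triangle_diff[of "z - a j" "x - a j"] by simp
    qed
    then show "\<exists>j \<gamma>. 0 < \<gamma> \<and> (\<forall>z. \<bar>u j z - u j x\<bar> < \<gamma> \<longrightarrow> p (z - x) < s)" using \<gamma> by blast
  qed
qed

text \<open>
  A sequence that converges to \<open>x\<close>, interleaved with the constant sequence \<open>x\<close>, is Cauchy; the limit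
  of the values of \<open>f\<close> along it must be \<open>f x\<close>.
\<close>
lemma Cauchy_continuous_imp_continuous:
  fixes f :: "'a \<Rightarrow> 'b::real_normed_vector"
  assumes f: "\<And>x :: nat \<Rightarrow> 'a. Metric_space.MCauchy UNIV (norm_dist p) x \<Longrightarrow> convergent (\<lambda>m. f (x m))"
    and e: "0 < e"
  shows "\<exists>s>0. \<forall>z. p (z - x) < s \<longrightarrow> norm (f z - f x) < e"
proof (rule ccontr)
  assume no: "\<not> ?thesis"
  have "\<forall>n::nat. \<exists>z. p (z - x) < 1 / real (n + 1) \<and> e \<le> norm (f z - f x)"
  proof
    fix n :: nat
    have "0 < 1 / real (n + 1)" by simp
    then show "\<exists>z. p (z - x) < 1 / real (n + 1) \<and> e \<le> norm (f z - f x)"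
      using no by (meson not_less)
  qed
  from choice[OF this] obtain z where
    z: "\<And>n. p (z n - x) < 1 / real (n + 1)" "\<And>n. e \<le> norm (f (z n) - f x)" by blast
  define y where "y n = (if even n then z n else x)" for n :: nat
  interpret N: Metric_space UNIV "norm_dist p"
    by (rule Metric_space_norm_dist[OF norm_on_space])
  have yx: "p (y n - x) < 1 / real (n + 1)" for n using z(1)[of n] by (simp add: y_def)
  have "N.MCauchy y"
    unfolding N.MCauchy_def
  proof (intro conjI allI impI)
    fix \<epsilon> :: real assume \<epsilon>: "0 < \<epsilon>"
    obtain N where N: "2 / \<epsilon> < real N" using reals_Archimedean2 by blast
    have "norm_dist p (y n) (y n') < \<epsilon>" if n: "N \<le> n" "N \<le> n'" for n n'
    proof -
      have small: "p (y k - x) < \<epsilon> / 2" if "N \<le> k" for k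
      proof -
        have "2 / \<epsilon> < real (k + 1)" using N that by linarith
        then have "1 / real (k + 1) < \<epsilon> / 2" using \<epsilon> by (simp add: field_simps)
        then show ?thesis using yx[of k] by linarith
      qed
      have "p (y n - y n') \<le> p (y n - x) + p (y n' - x)"
        using p_triangle_diff[of "y n - x" "y n' - x"] by simp
      then show ?thesis
        using small[OF n(1)] small[OF n(2)] unfolding norm_dist_def by linarith
    qed
    then show "\<exists>N. \<forall>n n'. N \<le> n \<longrightarrow> N \<le> n' \<longrightarrow> norm_dist p (y n) (y n') < \<epsilon>" by blast
  qed simp
  then obtain l where l: "(\<lambda>n. f (y n)) \<longlonglongrightarrow> l"
    using f unfolding convergent_def by blast
  have "(\<lambda>n. f (y (2 * n))) \<longlonglongrightarrow> l" "(\<lambda>n. f (y (2 * n + 1))) \<longlonglongrightarrow> l"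
    using LIMSEQ_subseq_LIMSEQ[OF l, of "\<lambda>n. 2 * n"] LIMSEQ_subseq_LIMSEQ[OF l, of "\<lambda>n. 2 * n + 1"]
    by (auto simp: o_def strict_mono_def)
  then have "(\<lambda>n. f (y (2 * n)) - f (y (2 * n + 1))) \<longlonglongrightarrow> l - l"
    by (rule tendsto_diff)
  then have "(\<lambda>n. norm (f (z (2 * n)) - f x)) \<longlonglongrightarrow> 0"
    by (simp add: y_def tendsto_norm_zero_iff)
  then have "e \<le> 0"
    by (rule tendsto_lowerbound) (use z(2) in auto)
  then show False using e by simp
qed

end

lemma majorant_imp_analytic_map:
  fixes p :: "'a::{real_vector,topological_space} \<Rightarrow> real" and H :: "'a \<Rightarrow> 'b::banach"
  assumes p: "norm_on_space p" and op: "\<And>x s. open {y. p (y - x) < s}"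
    and H: "\<And>x. \<exists>r M. norm_fun.majorant p x r H M"
  shows "analytic_map H"
proof -
  interpret norm_fun p by unfold_locales (rule p)
  have form_cont: "continuous_on UNIV (\<lambda>h. B (replicate n h))"
    if B: "bounded_form n B c" for n c and B :: "'a list \<Rightarrow> 'b"
    unfolding continuous_on_def
  proof
    fix x :: 'a
    let ?G = "\<lambda>h. B (replicate n h)"
    obtain M where M: "majorant x 1 ?G M" using majorant_translated_form[OF B, of 1 x 0] by auto
    have M0: "0 \<le> M" by (rule majorant_nonneg[OF M])
    show "(?G \<longlongrightarrow> ?G x) (at x)"
    proof (rule tendstoI)
      fix e :: real assume e: "0 < e"
      define s where "s = min 1 (e / (2 * (M + 1)))"
      have s: "0 < s" "s \<le> 1" using e M0 by (auto simp: s_def)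
      have "s * M \<le> e / (2 * (M + 1)) * (M + 1)"
        using M0 s e by (intro mult_mono) (auto simp: s_def)
      also have "\<dots> = e / 2" using M0 by (simp add: field_simps)
      finally have sM: "s * M < e" using e by simp
      have "dist (?G y) (?G x) < e" if "p (y - x) < s" for y
        using majorant_norm_le[OF majorant_shrink[OF M s], of "y - x"] that sM by (simp add: dist_norm)
      moreover have "open {y. p (y - x) < s}" "x \<in> {y. p (y - x) < s}" using op s by auto
      ultimately show "\<forall>\<^sub>F y in at x. dist (?G y) (?G x) < e"
        unfolding eventually_at_topological by blast
    qed
  qed
  show ?thesis
    unfolding analytic_map_def
  proof
    fix x
    obtain r M where "majorant x r H M" using H by blast
    then obtain B c where B0: "0 < r" "\<forall>n. bounded_form n (B n) (c n)"
      "\<forall>h. p h \<le> r \<longrightarrow> (\<lambda>n. B n (replicate n h)) sums H (x + h)"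
      "\<forall>n. 0 \<le> c n" "summable (\<lambda>n. c n * r ^ n)" "(\<Sum>n. c n * r ^ n) \<le> M"
      by (rule majorantE)
    note B = B0[rule_format]
    let ?V = "{h. p h \<le> r}" and ?G = "\<lambda>n h. B n (replicate n h)"
    show "\<exists>V G. (\<forall>\<^sub>F h in nhds 0. h \<in> V) \<and>
        (\<forall>n. continuous_on UNIV (G n) \<and> homogeneous_polynomial n (G n)) \<and>
        uniform_limit V (\<lambda>N h. \<Sum>n<N. G n h) (\<lambda>h. H (x + h)) sequentially"
    proof (intro exI[of _ ?V] exI[of _ ?G] conjI allI)
      have "open {h. p (h - 0) < r}" "0 \<in> {h. p (h - 0) < r}" using op[of 0 r] B(1) by auto
      moreover have "h \<in> ?V" if "h \<in> {h. p (h - 0) < r}" for h using that by simp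
      ultimately show "\<forall>\<^sub>F h in nhds 0. h \<in> ?V"
        unfolding eventually_nhds by blast
      show "continuous_on UNIV (?G n)" for n by (rule form_cont[OF B(2)])
      show "homogeneous_polynomial n (?G n)" for n
        using B(2)[of n] unfolding homogeneous_polynomial_def bounded_form_def by blast
      have lim: "uniform_limit ?V (\<lambda>N h. \<Sum>n<N. ?G n h) (\<lambda>h. \<Sum>n. ?G n h) sequentially"
        by (rule Weierstrass_m_test[OF _ B(5)]) (use form_term_le[OF B(2)] in blast)
      have eq: "(\<Sum>n. ?G n h) = H (x + h)" if "h \<in> ?V" for h
        using B(3)[of h] that by (simp add: sums_iff)
      show "uniform_limit ?V (\<lambda>N h. \<Sum>n<N. ?G n h) (\<lambda>h. H (x + h)) sequentially"
        by (rule iffD1[OF uniform_limit_cong' lim]) (rule refl, rule eq)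
    qed
  qed
qed

theorem mainTheorem1:
  fixes p :: "nat \<Rightarrow> 'a::{real_vector,topological_space} \<Rightarrow> real"
    and f :: "'a \<Rightarrow> 'b::banach"
  assumes "frechet_norms p"
    and "separable_space (euclidean :: 'a topology)"
    and "\<forall>n. \<exists>P. separating_polynomial (p n) P"
    and "\<exists>k. \<forall>x :: nat \<Rightarrow> 'a. Metric_space.MCauchy UNIV (norm_dist (p k)) x
                \<longrightarrow> convergent (\<lambda>m. f (x m))"
  shows "\<forall>\<epsilon>>0. \<exists>H :: 'a \<Rightarrow> 'b. analytic_map H \<and> (\<forall>x. norm (f x - H x) < \<epsilon>)"
proof (intro allI impI)
  fix \<epsilon> :: real assume \<epsilon>: "0 < \<epsilon>"
  obtain k where k: "\<And>x :: nat \<Rightarrow> 'a. Metric_space.MCauchy UNIV (norm_dist (p k)) x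
      \<Longrightarrow> convergent (\<lambda>m. f (x m))"
    using assms(4) by blast
  obtain P where P: "separating_polynomial (p k) P" using assms(3) by blast
  interpret norm_fun "p k"
    using assms(1) by unfold_locales (simp add: frechet_norms_def)
  have op: "open {y. p k (y - x) < s}" for x s
  proof -
    have "generate_topology {(\<lambda>x. p n (x - a)) -` U | n a U. open U} ((\<lambda>y. p k (y - x)) -` {..<s})"
      by (rule generate_topology.Basis, rule CollectI,
          rule exI[of _ k], rule exI[of _ x], rule exI[of _ "{..<s}"]) simp
    moreover have "(\<lambda>y. p k (y - x)) -` {..<s} = {y. p k (y - x) < s}" by auto
    ultimately show ?thesis using assms(1) by (simp add: frechet_norms_def)
  qed
  obtain C :: "'a set" where C: "countable C" "closure C = UNIV"
    using assms(2) by (auto simp: separable_space_def)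
  have meet: "\<exists>c\<in>C. p k (x - c) < s" if "0 < s" for x s
  proof -
    have "x \<in> {y. p k (y - x) < s} \<inter> closure C" using C(2) that by simp
    then have "{y. p k (y - x) < s} \<inter> C \<noteq> {}"
      using open_Int_closure_eq_empty[OF op, of x s C] by blast
    then obtain c where "c \<in> C" "p k (c - x) < s" by blast
    then show ?thesis by (auto simp: p_minus_commute[of x])
  qed
  then have "C \<noteq> {}" using meet[of 1 0] by auto
  have dense: "\<exists>j. p k (x - from_nat_into C j) < s" if "0 < s" for x s
    using meet[OF that, of x] from_nat_into_surj[OF C(1)] by metis
  from separating_coordinates[OF P dense] obtain u :: "nat \<Rightarrow> 'a \<Rightarrow> real" where
    u: "\<forall>j x. 0 \<le> u j x \<and> u j x \<le> 1"
    and osc: "\<forall>x \<delta>. 0 < \<delta> \<longrightarrow> (\<exists>r. \<forall>j. majorant x r (\<lambda>y. u j y - u j x) (\<delta> * (1/2) ^ j))"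
    and sep: "\<forall>x s. 0 < s \<longrightarrow> (\<exists>j \<gamma>. 0 < \<gamma> \<and> (\<forall>z. \<bar>u j z - u j x\<bar> < \<gamma> \<longrightarrow> p k (z - x) < s))"
    by blast
  have "\<exists>H. (\<forall>x. \<exists>r M. majorant x r H M) \<and> (\<forall>x. norm (f x - H x) \<le> 2 * (\<epsilon> / 3))"
  proof (rule analytic_approximation[of u])
    show "\<exists>s>0. \<forall>z. p k (z - x) < s \<longrightarrow> norm (f z - f x) < e" if "0 < e" for x e
      using k that by (rule Cauchy_continuous_imp_continuous)
  qed (use u osc sep \<epsilon> in auto)
  then obtain H where H: "\<And>x. \<exists>r M. majorant x r H M" "\<And>x. norm (f x - H x) \<le> 2 * (\<epsilon> / 3)"
    by blast
  have "analytic_map H"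
    by (rule majorant_imp_analytic_map[OF norm_on_space op H(1)])
  moreover have "norm (f x - H x) < \<epsilon>" for x using H(2)[of x] \<epsilon> by simp
  ultimately show "\<exists>H. analytic_map H \<and> (\<forall>x. norm (f x - H x) < \<epsilon>)" by blast
qed

end
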